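(* Let $d\in\mathbb{N}$, $p=(p_1,\dots,p_d)\in\mathbb{N}^d$, and suppose $V:\mathbb{Z}^d\to\mathbb{R}$ is $p$-periodic and non-degenerate. Put $p_0:=\min\{p_i : i=1,2,\dots,d\}$ and, for $\mu>0$, let $H_\mu=\Delta+\mu V$ on $\ell^2(\mathbb{Z}^d)$. Then, as $\mu\to\infty$, one has $$v_{\mathrm{asy}}(H_\mu)=C\mu^{-p_0+1}+O(\mu^{-p_0}),$$ where $C>0$ is a constant depending on $V$ and $p$. Moreover, as $\mu\to\infty$, $$v_{\mathrm{asy}}(H_\mu,\delta_0)=c\,\mu^{-p_0+1}+O(\mu^{-p_0})$$ for a constant $c>0$ depending on $V$ and $p$.
   Context: $\mathbb{N}=\{1,2,\dots\}$. The operator $\Delta$ on $\ell^2(\mathbb{Z}^d)$ is $[\Delta\psi](n)=\sum_{|n-m|_1=1}\psi(m)$ and $V$ acts by multiplication, so $[H_\mu\psi](n)=\mu V(n)\psi(n)+\sum_{|n-m|_1=1}\psi(m)$. The function $V$ is $p$-periodic if $V(n+m)=V(n)$ for all $n\in\mathbb{Z}^d$ and $m\in p_1\mathbb{Z}\oplus\cdots\oplus p_d\mathbb{Z}$. With $[\ell]=\{0,1,\dots,\ell-1\}$, the fundamental cell is $W=[p_1]\times\cdots\times[p_d]$, and a $p$-periodic $V$ is non-degenerate if $V$ is injective on $W$. $\{\delta_n:n\in\mathbb{Z}^d\}$ is the canonical basis of $\ell^2(\mathbb{Z}^d)$. The position operator $X:D(X)\subseteq\ell^2(\mathbb{Z}^d)\to(\ell^2(\mathbb{Z}^d))^d$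 is $X\psi=(X_1\psi,\dots,X_d\psi)$, $[X_i\psi](x)=x_i\psi(x)$, on its maximal domain $D(X)$. For a self-adjoint $H=\Delta+U$ with $U:\mathbb{Z}^d\to\mathbb{R}$ periodic and $\psi\in D(X)$, $$v_{\mathrm{asy}}(H,\psi):=\limsup_{t\to\infty}\frac1t\|Xe^{-\mathrm{i}tH}\psi\|,\qquad v_{\mathrm{asy}}(H):=\sup_{\psi\in D(X),\ \|\psi\|=1}v_{\mathrm{asy}}(H,\psi).$$ *)

theory Defs
  imports "HOL-Analysis.Analysis" "HOL-Library.Landau_Symbols"
begin

definition square_summable :: "('a \<Rightarrow> complex) \<Rightarrow> bool" where
  "square_summable f \<longleftrightarrow> (\<lambda>x. (cmod (f x))\<^sup>2) summable_on UNIV"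

lemma square_summable_zero: "square_summable (\<lambda>_. 0)"
  by (simp add: square_summable_def)

lemma square_summable_cmult:
  assumes "square_summable f"
  shows "square_summable (\<lambda>x. c * f x)"
  using assms unfolding square_summable_def
  by (simp add: norm_mult power_mult_distrib summable_on_cmult_right)

lemma square_summable_le:
  assumes "square_summable f" and "\<And>x. cmod (g x) \<le> cmod (f x)"
  shows "square_summable g"
  using assms unfolding square_summable_def
  by (auto intro!: summable_on_comparison_test[of "\<lambda>x. (cmod (f x))\<^sup>2"] power_mono)

lemma square_summable_add:
  assumes "square_summable f" "square_summable g"
  shows "square_summable (\<lambda>x. f x + g x)"
proof -
  have "(\<lambda>x. 2 * (cmod (f x))\<^sup>2 + 2 * (cmod (g x))\<^sup>2) summable_on UNIV"
    using assms unfolding square_summable_def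
    by (intro summable_on_add summable_on_cmult_right)
  moreover have "(cmod (f x + g x))\<^sup>2 \<le> 2 * (cmod (f x))\<^sup>2 + 2 * (cmod (g x))\<^sup>2" for x
  proof -
    have "(cmod (f x + g x))\<^sup>2 \<le> (cmod (f x) + cmod (g x))\<^sup>2"
      by (intro power_mono norm_triangle_ineq) auto
    also have "\<dots> \<le> 2 * (cmod (f x))\<^sup>2 + 2 * (cmod (g x))\<^sup>2"
      using sum_squares_bound[of "cmod (f x)" "cmod (g x)"] by (simp add: power2_sum)
    finally show ?thesis .
  qed
  ultimately show ?thesis
    unfolding square_summable_def by (rule summable_on_comparison_test) auto
qed

lemma square_summable_inner:
  assumes "square_summable f" "square_summable g"
  shows "(\<lambda>x. inner (f x) (g x)) summable_on UNIV"
proof -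
  have "(\<lambda>x. (cmod (f x))\<^sup>2 + (cmod (g x))\<^sup>2) summable_on UNIV"
    using assms unfolding square_summable_def by (intro summable_on_add)
  moreover have "norm (inner (f x) (g x)) \<le> (cmod (f x))\<^sup>2 + (cmod (g x))\<^sup>2" for x
  proof -
    have "norm (inner (f x) (g x)) \<le> cmod (f x) * cmod (g x)"
      by (simp add: Cauchy_Schwarz_ineq2)
    also have "\<dots> \<le> (cmod (f x))\<^sup>2 + (cmod (g x))\<^sup>2"
      using sum_squares_bound[of "cmod (f x)" "cmod (g x)"]
        mult_nonneg_nonneg[OF norm_ge_zero[of "f x"] norm_ge_zero[of "g x"]] by linarith
    finally show ?thesis .
  qed
  ultimately have "(\<lambda>x. norm (inner (f x) (g x))) summable_on UNIV"
    by (rule summable_on_comparison_test) auto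
  then show ?thesis
    by (rule abs_summable_summable)
qed

typedef 'a ell2 = "{f :: 'a \<Rightarrow> complex. square_summable f}"
  using square_summable_zero by blast

setup_lifting type_definition_ell2

lemma square_summable_Rep_ell2: "square_summable (Rep_ell2 \<psi>)"
  using Rep_ell2 by blast

lemma Rep_Abs_ell2: "square_summable f \<Longrightarrow> Rep_ell2 (Abs_ell2 f) = f"
  by (simp add: Abs_ell2_inverse)

lemma ell2_eqI: "(\<And>x. Rep_ell2 \<phi> x = Rep_ell2 \<psi> x) \<Longrightarrow> \<phi> = \<psi>"
  by (metis Rep_ell2_inverse ext)

instantiation ell2 :: (type) real_vector
begin

lift_definition zero_ell2 :: "'a ell2" is "\<lambda>_. 0"
  by (rule square_summable_zero)

lift_definition plus_ell2 :: "'a ell2 \<Rightarrow> 'a ell2 \<Rightarrow> 'a ell2" is "\<lambda>f g x. f x + g x"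
  by (rule square_summable_add)

lift_definition uminus_ell2 :: "'a ell2 \<Rightarrow> 'a ell2" is "\<lambda>f x. - f x"
  by (simp add: square_summable_def)

lift_definition minus_ell2 :: "'a ell2 \<Rightarrow> 'a ell2 \<Rightarrow> 'a ell2" is "\<lambda>f g x. f x - g x"
  using square_summable_add[of _ "\<lambda>x. - g x" for g] by (auto simp: square_summable_def)

lift_definition scaleR_ell2 :: "real \<Rightarrow> 'a ell2 \<Rightarrow> 'a ell2" is "\<lambda>r f x. r *\<^sub>R f x"
  by (simp add: scaleR_conv_of_real square_summable_cmult)

instance
  by (standard; transfer) (simp_all add: algebra_simps scaleR_add_left scaleR_add_right fun_eq_iff)

end

(* The class real_inner carries the real part of the Hermitian inner product; both have
   the same norm. *)
instantiation ell2 :: (type) real_inner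
begin

definition norm_ell2 :: "'a ell2 \<Rightarrow> real" where
  "norm_ell2 \<psi> = sqrt (\<Sum>\<^sub>\<infinity>x. (cmod (Rep_ell2 \<psi> x))\<^sup>2)"

definition inner_ell2 :: "'a ell2 \<Rightarrow> 'a ell2 \<Rightarrow> real" where
  "inner_ell2 \<phi> \<psi> = (\<Sum>\<^sub>\<infinity>x. inner (Rep_ell2 \<phi> x) (Rep_ell2 \<psi> x))"

definition dist_ell2 :: "'a ell2 \<Rightarrow> 'a ell2 \<Rightarrow> real" where
  "dist_ell2 \<phi> \<psi> = norm (\<phi> - \<psi>)"

definition sgn_ell2 :: "'a ell2 \<Rightarrow> 'a ell2" where
  "sgn_ell2 \<psi> = inverse (norm \<psi>) *\<^sub>R \<psi>"

definition uniformity_ell2 :: "('a ell2 \<times> 'a ell2) filter" where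
  "uniformity_ell2 = (INF e\<in>{0<..}. principal {(\<phi>, \<psi>). dist \<phi> \<psi> < e})"

definition open_ell2 :: "'a ell2 set \<Rightarrow> bool" where
  "open_ell2 U \<longleftrightarrow> (\<forall>\<phi>\<in>U. eventually (\<lambda>(\<phi>', \<psi>). \<phi>' = \<phi> \<longrightarrow> \<psi> \<in> U) uniformity)"

instance
proof
  fix \<phi> \<psi> \<xi> :: "'a ell2" and r :: real
  note S = square_summable_inner[OF square_summable_Rep_ell2 square_summable_Rep_ell2]
  show "inner \<phi> \<psi> = inner \<psi> \<phi>"
    by (simp add: inner_ell2_def inner_commute)
  show "inner (\<phi> + \<psi>) \<xi> = inner \<phi> \<xi> + inner \<psi> \<xi>"
    by (simp add: inner_ell2_def plus_ell2.rep_eq inner_add_left infsum_add[OF S S])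
  show "inner (r *\<^sub>R \<phi>) \<psi> = r * inner \<phi> \<psi>"
    by (simp add: inner_ell2_def scaleR_ell2.rep_eq infsum_cmult_right')
  show "0 \<le> inner \<phi> \<phi>"
    by (simp add: inner_ell2_def infsum_nonneg)
  show "inner \<phi> \<phi> = 0 \<longleftrightarrow> \<phi> = 0"
  proof
    assume "inner \<phi> \<phi> = 0"
    then have "inner (Rep_ell2 \<phi> x) (Rep_ell2 \<phi> x) = 0" for x
      using nonneg_infsum_le_0D[OF _ S, of \<phi> \<phi> x] by (simp add: inner_ell2_def)
    then show "\<phi> = 0"
      by (intro ell2_eqI) (simp add: zero_ell2.rep_eq)
  qed (simp add: inner_ell2_def zero_ell2.rep_eq)
  show "norm \<phi> = sqrt (inner \<phi> \<phi>)"
    by (simp add: norm_ell2_def inner_ell2_def power2_norm_eq_inner)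
qed (auto simp: dist_ell2_def sgn_ell2_def uniformity_ell2_def open_ell2_def)

end

lemma norm_ell2_power2: "(norm \<psi>)\<^sup>2 = (\<Sum>\<^sub>\<infinity>x. (cmod (Rep_ell2 \<psi> x))\<^sup>2)"
  by (simp add: norm_ell2_def infsum_nonneg)

lemma finite_sum_le_norm_ell2:
  assumes "finite F"
  shows "(\<Sum>x\<in>F. (cmod (Rep_ell2 \<psi> x))\<^sup>2) \<le> (norm \<psi>)\<^sup>2"
  unfolding norm_ell2_power2
  using assms square_summable_Rep_ell2[of \<psi>] unfolding square_summable_def
  by (intro finite_sum_le_infsum) auto

lemma cmod_le_norm_ell2: "cmod (Rep_ell2 \<psi> x) \<le> norm \<psi>"
  using finite_sum_le_norm_ell2[of "{x}" \<psi>] by (simp add: power2_le_iff_abs_le)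

lemma square_summable_finite_bound:
  assumes "\<And>F. finite F \<Longrightarrow> (\<Sum>x\<in>F. (cmod (f x))\<^sup>2) \<le> B"
  shows "square_summable f"
  unfolding square_summable_def
  by (rule nonneg_bdd_above_summable_on) (auto intro!: bdd_aboveI2 assms)

lemma norm_ell2_le:
  assumes "\<And>F. finite F \<Longrightarrow> (\<Sum>x\<in>F. (cmod (Rep_ell2 \<psi> x))\<^sup>2) \<le> B\<^sup>2" and "0 \<le> B"
  shows "norm \<psi> \<le> B"
proof -
  have "(norm \<psi>)\<^sup>2 \<le> B\<^sup>2"
    unfolding norm_ell2_power2
    using square_summable_Rep_ell2[of \<psi>] unfolding square_summable_def
    by (rule infsum_le_finite_sums) (use assms in auto)
  then show ?thesis
    using assms(2) power2_le_imp_le by blast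
qed

instance ell2 :: (type) banach
proof
  fix X :: "nat \<Rightarrow> 'a ell2"
  assume X: "Cauchy X"
  have "Cauchy (\<lambda>n. Rep_ell2 (X n) x)" for x
  proof (rule metric_CauchyI)
    fix e :: real
    assume "0 < e"
    then obtain M where M: "\<And>m n. m \<ge> M \<Longrightarrow> n \<ge> M \<Longrightarrow> dist (X m) (X n) < e"
      using metric_CauchyD[OF X] by blast
    have "dist (Rep_ell2 (X m) x) (Rep_ell2 (X n) x) < e" if "m \<ge> M" "n \<ge> M" for m n
      using cmod_le_norm_ell2[of "X m - X n" x] M[OF that]
      by (simp add: dist_norm minus_ell2.rep_eq)
    then show "\<exists>M. \<forall>m\<ge>M. \<forall>n\<ge>M. dist (Rep_ell2 (X m) x) (Rep_ell2 (X n) x) < e"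
      by blast
  qed
  then have "\<exists>g. \<forall>x. (\<lambda>n. Rep_ell2 (X n) x) \<longlonglongrightarrow> g x"
    by (intro choice) (auto simp: Cauchy_convergent_iff convergent_def)
  then obtain g where g: "\<And>x. (\<lambda>n. Rep_ell2 (X n) x) \<longlonglongrightarrow> g x"
    by blast
  have bound: "\<exists>M. \<forall>m\<ge>M. \<forall>F. finite F \<longrightarrow> (\<Sum>x\<in>F. (cmod (Rep_ell2 (X m) x - g x))\<^sup>2) \<le> e\<^sup>2"
    if e: "0 < e" for e :: real
  proof -
    obtain M where M: "\<And>m n. m \<ge> M \<Longrightarrow> n \<ge> M \<Longrightarrow> dist (X m) (X n) < e"
      using metric_CauchyD[OF X e] by blast
    have "(\<Sum>x\<in>F. (cmod (Rep_ell2 (X m) x - g x))\<^sup>2) \<le> e\<^sup>2" if "m \<ge> M" "finite F" for m F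
    proof (rule tendsto_upperbound)
      show "(\<lambda>n. \<Sum>x\<in>F. (cmod (Rep_ell2 (X m) x - Rep_ell2 (X n) x))\<^sup>2)
          \<longlonglongrightarrow> (\<Sum>x\<in>F. (cmod (Rep_ell2 (X m) x - g x))\<^sup>2)"
        by (intro tendsto_intros g)
      have "(\<Sum>x\<in>F. (cmod (Rep_ell2 (X m) x - Rep_ell2 (X n) x))\<^sup>2) \<le> e\<^sup>2" if "n \<ge> M" for n
      proof -
        have "(\<Sum>x\<in>F. (cmod (Rep_ell2 (X m) x - Rep_ell2 (X n) x))\<^sup>2) \<le> (norm (X m - X n))\<^sup>2"
          using finite_sum_le_norm_ell2[OF \<open>finite F\<close>, of "X m - X n"]
          by (simp add: minus_ell2.rep_eq)
        also have "\<dots> \<le> e\<^sup>2"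
          using M[OF \<open>m \<ge> M\<close> that] by (intro power_mono) (auto simp: dist_norm)
        finally show ?thesis .
      qed
      then show "\<forall>\<^sub>F n in sequentially.
          (\<Sum>x\<in>F. (cmod (Rep_ell2 (X m) x - Rep_ell2 (X n) x))\<^sup>2) \<le> e\<^sup>2"
        by (auto simp: eventually_sequentially)
    qed simp
    then show ?thesis by blast
  qed
  have g_mem: "square_summable g"
  proof -
    obtain M where "\<And>F. finite F \<Longrightarrow> (\<Sum>x\<in>F. (cmod (Rep_ell2 (X M) x - g x))\<^sup>2) \<le> 1\<^sup>2"
      using bound[OF zero_less_one] by blast
    then have "square_summable (\<lambda>x. Rep_ell2 (X M) x - g x)"
      by (rule square_summable_finite_bound)
    then have "square_summable (\<lambda>x. Rep_ell2 (X M) x + (-1) * (Rep_ell2 (X M) x - g x))"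
      by (intro square_summable_add square_summable_cmult square_summable_Rep_ell2)
    then show ?thesis by simp
  qed
  have "X \<longlonglongrightarrow> Abs_ell2 g"
  proof (rule metric_LIMSEQ_I)
    fix e :: real
    assume "0 < e"
    then obtain M where M: "\<And>m F. m \<ge> M \<Longrightarrow> finite F \<Longrightarrow>
        (\<Sum>x\<in>F. (cmod (Rep_ell2 (X m) x - g x))\<^sup>2) \<le> (e / 2)\<^sup>2"
      using bound[OF half_gt_zero] by blast
    have "dist (X m) (Abs_ell2 g) \<le> e / 2" if "m \<ge> M" for m
      unfolding dist_norm
      by (rule norm_ell2_le)
        (use M[OF that] \<open>0 < e\<close> in \<open>auto simp: minus_ell2.rep_eq Rep_Abs_ell2[OF g_mem]\<close>)
    then show "\<exists>M. \<forall>m\<ge>M. dist (X m) (Abs_ell2 g) < e"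
      using \<open>0 < e\<close> by (intro exI[of _ M]) force
  qed
  then show "convergent X"
    by (auto simp: convergent_def)
qed

lift_definition scaleC_ell2 :: "complex \<Rightarrow> 'a ell2 \<Rightarrow> 'a ell2" is "\<lambda>c f x. c * f x"
  by (rule square_summable_cmult)

lift_definition ket :: "'a \<Rightarrow> 'a ell2" is "\<lambda>n x. if x = n then 1 else 0"
proof -
  fix n :: 'a
  have "(\<lambda>x. (cmod (if x = n then 1 else 0))\<^sup>2) summable_on UNIV
      \<longleftrightarrow> (\<lambda>x. (cmod (if x = n then 1 else 0))\<^sup>2) summable_on {n}"
    by (rule summable_on_cong_neutral) auto
  then show "square_summable (\<lambda>x. if x = n then 1 else 0)"
    by (simp add: square_summable_def)
qed

lemma norm_scaleC_ell2: "norm (scaleC_ell2 c \<psi>) = cmod c * norm \<psi>"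
  by (simp add: norm_ell2_def scaleC_ell2.rep_eq norm_mult power_mult_distrib
      infsum_cmult_right' real_sqrt_mult)

lemma bounded_linear_scaleC_ell2: "bounded_linear (scaleC_ell2 c)"
proof (rule bounded_linear_intro[where K = "cmod c"])
  show "scaleC_ell2 c (\<phi> + \<psi>) = scaleC_ell2 c \<phi> + scaleC_ell2 c \<psi>" for \<phi> \<psi> :: "'a ell2"
    by transfer (simp add: algebra_simps)
  show "scaleC_ell2 c (r *\<^sub>R \<psi>) = r *\<^sub>R scaleC_ell2 c \<psi>" for r and \<psi> :: "'a ell2"
    by transfer simp
qed (simp add: norm_scaleC_ell2)

definition op_scaleC :: "complex \<Rightarrow> ('a ell2 \<Rightarrow>\<^sub>L 'a ell2) \<Rightarrow> ('a ell2 \<Rightarrow>\<^sub>L 'a ell2)" where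
  "op_scaleC c A = Blinfun (scaleC_ell2 c) o\<^sub>L A"

lemma op_scaleC_apply: "op_scaleC c A \<psi> = scaleC_ell2 c (A \<psi>)"
  by (simp add: op_scaleC_def bounded_linear_Blinfun_apply[OF bounded_linear_scaleC_ell2])

primrec op_power :: "('v::real_normed_vector \<Rightarrow>\<^sub>L 'v) \<Rightarrow> nat \<Rightarrow> ('v \<Rightarrow>\<^sub>L 'v)" where
  "op_power A 0 = id_blinfun"
| "op_power A (Suc k) = A o\<^sub>L op_power A k"

(* The series converges in operator norm, by summable_op_exp. *)
definition op_exp :: "('v::banach \<Rightarrow>\<^sub>L 'v) \<Rightarrow> ('v \<Rightarrow>\<^sub>L 'v)" where
  "op_exp A = (\<Sum>k. (1 / fact k) *\<^sub>R op_power A k)"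

lemma norm_op_power_le: "norm (op_power A k) \<le> norm A ^ k"
proof (induction k)
  case 0
  show ?case
    using norm_blinfun_id_le by simp
next
  case (Suc k)
  have "norm (op_power A (Suc k)) \<le> norm A * norm (op_power A k)"
    using norm_blinfun_compose by simp
  also have "\<dots> \<le> norm A * norm A ^ k"
    by (intro mult_left_mono Suc) auto
  finally show ?case by simp
qed

lemma summable_op_exp:
  fixes A :: "'v::banach \<Rightarrow>\<^sub>L 'v"
  shows "summable (\<lambda>k. (1 / fact k) *\<^sub>R op_power A k)"
proof (rule summable_comparison_test')
  show "summable (\<lambda>k. norm A ^ k /\<^sub>R fact k)"
    by (rule summable_exp_generic)
  show "norm ((1 / fact k) *\<^sub>R op_power A k) \<le> norm A ^ k /\<^sub>R fact k" if "k \<ge> 0" for k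
    using norm_op_power_le[of A k] by (simp add: divide_simps)
qed

definition evolution :: "('a ell2 \<Rightarrow>\<^sub>L 'a ell2) \<Rightarrow> real \<Rightarrow> ('a ell2 \<Rightarrow>\<^sub>L 'a ell2)" where
  "evolution H t = op_exp (op_scaleC (- \<i> * complex_of_real t) H)"

definition l1_norm :: "int ^ 'd::finite \<Rightarrow> int" where
  "l1_norm n = (\<Sum>i\<in>UNIV. \<bar>n $ i\<bar>)"

(* Blinfun is only meaningful on bounded linear maps: laplacian_apply and mult_op_apply
   give the action of these operators, the latter for bounded U. *)
definition laplacian :: "(int ^ 'd::finite) ell2 \<Rightarrow>\<^sub>L (int ^ 'd) ell2" where
  "laplacian = Blinfun (\<lambda>\<psi>. Abs_ell2 (\<lambda>n. \<Sum>m | l1_norm (n - m) = 1. Rep_ell2 \<psi> m))"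

definition mult_op :: "('a \<Rightarrow> real) \<Rightarrow> ('a ell2 \<Rightarrow>\<^sub>L 'a ell2)" where
  "mult_op U = Blinfun (\<lambda>\<psi>. Abs_ell2 (\<lambda>n. complex_of_real (U n) * Rep_ell2 \<psi> n))"

definition schroedinger ::
  "real \<Rightarrow> (int ^ 'd::finite \<Rightarrow> real) \<Rightarrow> ((int ^ 'd) ell2 \<Rightarrow>\<^sub>L (int ^ 'd) ell2)" where
  "schroedinger \<mu> V = laplacian + mult_op (\<lambda>n. \<mu> * V n)"

definition periodic :: "nat ^ 'd::finite \<Rightarrow> (int ^ 'd \<Rightarrow> real) \<Rightarrow> bool" where
  "periodic p V \<longleftrightarrow> (\<forall>n m. (\<forall>i. int (p $ i) dvd m $ i) \<longrightarrow> V (n + m) = V n)"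

definition fundamental_cell :: "nat ^ 'd::finite \<Rightarrow> (int ^ 'd) set" where
  "fundamental_cell p = {n. \<forall>i. 0 \<le> n $ i \<and> n $ i < int (p $ i)}"

definition non_degenerate :: "nat ^ 'd::finite \<Rightarrow> (int ^ 'd \<Rightarrow> real) \<Rightarrow> bool" where
  "non_degenerate p V \<longleftrightarrow> inj_on V (fundamental_cell p)"

lemma mult_op_apply:
  assumes "bounded (range U)"
  shows "Rep_ell2 (mult_op U \<psi>) n = complex_of_real (U n) * Rep_ell2 \<psi> n"
proof -
  obtain B where B: "0 < B" "\<And>n. \<bar>U n\<bar> \<le> B"
    using assms unfolding bounded_pos by auto
  have le: "cmod (complex_of_real (U n) * Rep_ell2 \<phi> n) \<le> cmod (complex_of_real B * Rep_ell2 \<phi> n)"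
    for \<phi> n
    using B by (simp add: norm_mult mult_right_mono)
  have mem: "square_summable (\<lambda>n. complex_of_real (U n) * Rep_ell2 \<phi> n)" for \<phi>
    using square_summable_cmult[OF square_summable_Rep_ell2] le by (rule square_summable_le)
  define M where "M = (\<lambda>\<phi>. Abs_ell2 (\<lambda>n. complex_of_real (U n) * Rep_ell2 \<phi> n))"
  have Rep_M: "Rep_ell2 (M \<phi>) n = complex_of_real (U n) * Rep_ell2 \<phi> n" for \<phi> n
    by (simp add: M_def Rep_Abs_ell2[OF mem])
  have "bounded_linear M"
  proof (rule bounded_linear_intro[where K = B])
    show "M (\<phi> + \<xi>) = M \<phi> + M \<xi>" for \<phi> \<xi>
      by (rule ell2_eqI) (simp add: Rep_M plus_ell2.rep_eq algebra_simps)
    show "M (r *\<^sub>R \<phi>) = r *\<^sub>R M \<phi>" for r \<phi>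
      by (rule ell2_eqI) (simp add: Rep_M scaleR_ell2.rep_eq)
    show "norm (M \<phi>) \<le> norm \<phi> * B" for \<phi>
    proof (rule norm_ell2_le)
      fix F :: "'a set"
      assume F: "finite F"
      have "(\<Sum>x\<in>F. (cmod (Rep_ell2 (M \<phi>) x))\<^sup>2) \<le> (\<Sum>x\<in>F. B\<^sup>2 * (cmod (Rep_ell2 \<phi> x))\<^sup>2)"
      proof (rule sum_mono)
        fix x
        have "(cmod (Rep_ell2 (M \<phi>) x))\<^sup>2 \<le> (cmod (complex_of_real B * Rep_ell2 \<phi> x))\<^sup>2"
          unfolding Rep_M by (intro power_mono le) auto
        then show "(cmod (Rep_ell2 (M \<phi>) x))\<^sup>2 \<le> B\<^sup>2 * (cmod (Rep_ell2 \<phi> x))\<^sup>2"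
          by (simp add: norm_mult power_mult_distrib)
      qed
      also have "\<dots> \<le> B\<^sup>2 * (norm \<phi>)\<^sup>2"
        using finite_sum_le_norm_ell2[OF F, of \<phi>]
        by (simp add: mult_left_mono flip: sum_distrib_left)
      finally show "(\<Sum>x\<in>F. (cmod (Rep_ell2 (M \<phi>) x))\<^sup>2) \<le> (norm \<phi> * B)\<^sup>2"
        by (simp add: power_mult_distrib mult.commute)
    qed (use B in auto)
  qed
  then show ?thesis
    by (simp add: mult_op_def bounded_linear_Blinfun_apply Rep_M flip: M_def)
qed

lemma finite_l1_norm_eq: "finite {n :: int ^ 'd::finite. l1_norm n = k}"
proof (rule finite_subset)
  show "{n :: int ^ 'd. l1_norm n = k} \<subseteq> vec_lambda ` (UNIV \<rightarrow>\<^sub>E {-k..k})"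
  proof
    fix n :: "int ^ 'd"
    assume "n \<in> {n. l1_norm n = k}"
    then have "\<bar>n $ i\<bar> \<le> k" for i
      unfolding l1_norm_def using member_le_sum[of i UNIV "\<lambda>i. \<bar>n $ i\<bar>"] by auto
    then have "vec_nth n \<in> UNIV \<rightarrow>\<^sub>E {-k..k}"
      by (auto simp: abs_le_iff minus_le_iff)
    then show "n \<in> vec_lambda ` (UNIV \<rightarrow>\<^sub>E {-k..k})"
      by (metis image_eqI vec_nth_inverse)
  qed
  show "finite (vec_lambda ` ((UNIV :: 'd set) \<rightarrow>\<^sub>E {-k..k}))"
    by (intro finite_imageI finite_PiE) auto
qed

lemma l1_norm_minus: "l1_norm (- n) = l1_norm n"
  by (simp add: l1_norm_def)

lemma laplacian_apply:
  fixes \<psi> :: "(int ^ 'd::finite) ell2"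
  shows "Rep_ell2 (laplacian \<psi>) n = (\<Sum>m | l1_norm (n - m) = 1. Rep_ell2 \<psi> m)"
proof -
  define E where "E = {e :: int ^ 'd. l1_norm e = 1}"
  define S where "S = (\<lambda>(e :: int ^ 'd) \<phi>. Abs_ell2 (\<lambda>n. Rep_ell2 \<phi> (n + e)))"
  have fin: "finite E"
    unfolding E_def by (rule finite_l1_norm_eq)
  have bij: "bij (\<lambda>n. n + e)" for e :: "int ^ 'd"
    by (rule o_bij[of "\<lambda>n. n - e"]) (auto simp: fun_eq_iff)
  have mem: "square_summable (\<lambda>n. Rep_ell2 \<phi> (n + e))" for e and \<phi> :: "(int ^ 'd) ell2"
    using square_summable_Rep_ell2[of \<phi>] unfolding square_summable_def
    using summable_on_reindex_bij_betw[OF bij[of e], of "\<lambda>n. (cmod (Rep_ell2 \<phi> n))\<^sup>2"] by simp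
  have Rep_S: "Rep_ell2 (S e \<phi>) n = Rep_ell2 \<phi> (n + e)" for e \<phi> n
    by (simp add: S_def Rep_Abs_ell2[OF mem])
  have S_bl: "bounded_linear (S e)" for e
  proof (rule bounded_linear_intro[where K = 1])
    show "S e (\<phi> + \<xi>) = S e \<phi> + S e \<xi>" for \<phi> \<xi>
      by (rule ell2_eqI) (simp add: Rep_S plus_ell2.rep_eq)
    show "S e (r *\<^sub>R \<phi>) = r *\<^sub>R S e \<phi>" for r \<phi>
      by (rule ell2_eqI) (simp add: Rep_S scaleR_ell2.rep_eq)
    show "norm (S e \<phi>) \<le> norm \<phi> * 1" for \<phi>
      using infsum_reindex_bij_betw[OF bij[of e], of "\<lambda>n. (cmod (Rep_ell2 \<phi> n))\<^sup>2"]
      by (simp add: norm_ell2_def Rep_S)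
  qed
  have Rep_sum: "Rep_ell2 (\<Sum>e\<in>G. S e \<phi>) n = (\<Sum>e\<in>G. Rep_ell2 \<phi> (n + e))" for G \<phi> n
    by (induction G rule: infinite_finite_induct)
      (simp_all add: zero_ell2.rep_eq plus_ell2.rep_eq Rep_S)
  have reindex: "(\<Sum>m | l1_norm (n - m) = 1. Rep_ell2 \<phi> m) = Rep_ell2 (\<Sum>e\<in>E. S e \<phi>) n"
    for \<phi> :: "(int ^ 'd) ell2" and n
    unfolding Rep_sum
  proof (rule sum.reindex_bij_witness[of _ "\<lambda>e. n + e" "\<lambda>m. m - n"])
    show "m - n \<in> E" if "m \<in> {m. l1_norm (n - m) = 1}" for m
      using that l1_norm_minus[of "n - m"] by (simp add: E_def)
    show "n + e \<in> {m. l1_norm (n - m) = 1}" if "e \<in> E" for e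
      using that by (simp add: E_def l1_norm_minus)
  qed auto
  have "(\<lambda>\<phi>. Abs_ell2 (\<lambda>n. \<Sum>m | l1_norm (n - m) = 1. Rep_ell2 \<phi> m)) = (\<lambda>\<phi>. \<Sum>e\<in>E. S e \<phi>)"
    by (simp add: reindex Rep_ell2_inverse)
  moreover have "bounded_linear (\<lambda>\<phi>. \<Sum>e\<in>E. S e \<phi>)"
    by (intro bounded_linear_sum S_bl)
  ultimately show ?thesis
    by (simp add: laplacian_def bounded_linear_Blinfun_apply reindex)
qed

lemma periodic_imp_bounded:
  assumes "periodic p V" and "\<And>i. 1 \<le> p $ i"
  shows "bounded (range V)"
proof -
  have "range V \<subseteq> V ` fundamental_cell p"
  proof
    fix y
    assume "y \<in> range V"
    then obtain n where y: "y = V n" by auto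
    define w :: "int ^ 'a" where "w = (\<chi> i. n $ i mod int (p $ i))"
    have "\<forall>i. int (p $ i) dvd (n - w) $ i"
      by (simp add: w_def minus_mod_eq_mult_div)
    then have "V (w + (n - w)) = V w"
      using assms(1) unfolding periodic_def by blast
    moreover have "w \<in> fundamental_cell p"
      using assms(2) by (auto simp: w_def fundamental_cell_def Suc_le_eq)
    ultimately show "y \<in> V ` fundamental_cell p"
      by (simp add: y)
  qed
  moreover have "finite (fundamental_cell p)"
  proof (rule finite_subset)
    show "fundamental_cell p \<subseteq> vec_lambda ` (\<Pi>\<^sub>E i\<in>UNIV. {0..int (p $ i)})"
    proof
      fix n
      assume "n \<in> fundamental_cell p"
      then have "vec_nth n \<in> (\<Pi>\<^sub>E i\<in>UNIV. {0..int (p $ i)})"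
        by (auto simp: fundamental_cell_def less_imp_le)
      then show "n \<in> vec_lambda ` (\<Pi>\<^sub>E i\<in>UNIV. {0..int (p $ i)})"
        by (metis image_eqI vec_nth_inverse)
    qed
    show "finite (vec_lambda ` (\<Pi>\<^sub>E i\<in>(UNIV :: 'a set). {0..int (p $ i)}))"
      by (intro finite_imageI finite_PiE) auto
  qed
  ultimately show ?thesis
    by (meson bounded_subset finite_imageI finite_imp_bounded)
qed

lemma schroedinger_apply:
  assumes "periodic p V" and "\<And>i. 1 \<le> p $ i"
  shows "Rep_ell2 (schroedinger \<mu> V \<psi>) n =
    complex_of_real (\<mu> * V n) * Rep_ell2 \<psi> n + (\<Sum>m | l1_norm (n - m) = 1. Rep_ell2 \<psi> m)"
proof -
  have "bounded (range (\<lambda>n. \<mu> * V n))"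
    using bounded_scaling[OF periodic_imp_bounded[OF assms], of \<mu>] by (simp add: image_image)
  then show ?thesis
    by (simp add: schroedinger_def blinfun.add_left plus_ell2.rep_eq laplacian_apply mult_op_apply)
qed

definition position_domain :: "(int ^ 'd::finite) ell2 set" where
  "position_domain = {\<psi>. \<forall>i. square_summable (\<lambda>x. of_int (x $ i) * Rep_ell2 \<psi> x)}"

(* Only meaningful on position_domain.  The norm on the target type is the Euclidean combination
   of the component norms, i.e. that of the d-fold Hilbert space direct sum. *)
definition position :: "(int ^ 'd::finite) ell2 \<Rightarrow> (int ^ 'd) ell2 ^ 'd" where
  "position \<psi> = (\<chi> i. Abs_ell2 (\<lambda>x. of_int (x $ i) * Rep_ell2 \<psi> x))"

(* For bounded H = laplacian + mult_op U with U real, the evolution leaves position_domain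
   invariant, so position is applied within its domain here.  Values are in ereal so that
   limsup and supremum exist without a side condition. *)
definition v_asy_state ::
  "((int ^ 'd::finite) ell2 \<Rightarrow>\<^sub>L (int ^ 'd) ell2) \<Rightarrow> (int ^ 'd) ell2 \<Rightarrow> ereal" where
  "v_asy_state H \<psi> = Limsup at_top (\<lambda>t::real. ereal (1 / t * norm (position (evolution H t \<psi>))))"

definition v_asy :: "((int ^ 'd::finite) ell2 \<Rightarrow>\<^sub>L (int ^ 'd) ell2) \<Rightarrow> ereal" where
  "v_asy H = (SUP \<psi>\<in>{\<psi> \<in> position_domain. norm \<psi> = 1}. v_asy_state H \<psi>)"

end

theory Submission
  imports Defs
begin

text \<open>
  With $\epsilon = 1/\mu$, the operator $H_\mu$ is conjugated to $\mu V + b$ by $s$, where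
  $s = \sum_k \epsilon^k S_k$ and $b = \sum_k \epsilon^k B_k$ solve $H_\mu s = s (\mu V + b)$, the
  kernel of $b$ couples only sites that agree modulo the periods, and $S_0 = 1$ while the $S_k$
  with $k \geq 1$ couple only sites that do not. The level sets of $V$ are exactly the classes of
  sites modulo the periods, so commutation with $V$ can be inverted off the block diagonal, which
  determines $S_{k+1}$ recursively; the norms of the coefficients are dominated by Catalan numbers.

  The operator $b$ and its commutators $Q_i = [X_i, b]$ with the position operators are
  convolutions on every class, hence commute. Thus $X_i$ evolves exactly linearly under
  $\mu V + b$, no Floquet transform is needed, and
  $v_{asy}(H_\mu, \psi) = \|(s Q_i s^{-1} \psi)_i\|$.
  The kernel of $B_k$ has range $k + 1$, so that $[X_i, B_k] = 0$ for $k + 1 < p_0$, and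
  $T_i = [X_i, B_{p_0 - 1}]$ gives the leading term: $C$ and $c$ are the norm of $T$ and the norm of
  $T \delta_0$. They do not vanish since only the straight path joins two sites that differ by
  $p_0$ times a unit vector in $p_0$ steps.
\<close>

section \<open>The Banach algebra of complex-linear bounded operators\<close>

lemma scaleC_ell2_add_right: "scaleC_ell2 c (\<phi> + \<psi>) = scaleC_ell2 c \<phi> + scaleC_ell2 c \<psi>"
  by (rule linear_add) (rule bounded_linear.linear[OF bounded_linear_scaleC_ell2])

lemma scaleC_ell2_scaleR: "scaleC_ell2 c (r *\<^sub>R \<psi>) = r *\<^sub>R scaleC_ell2 c \<psi>"
  by (rule linear_scale) (rule bounded_linear.linear[OF bounded_linear_scaleC_ell2])

text \<open>Reduces complex scalars to real ones and \<open>\<i>\<close>, so that commutation with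
  \<open>\<i>\<close> alone gives \<open>app_scaleC\<close>.\<close>

lemma scaleC_ell2_conv: "scaleC_ell2 c \<psi> = Re c *\<^sub>R \<psi> + Im c *\<^sub>R scaleC_ell2 \<i> \<psi>"
  by (rule ell2_eqI)
    (simp add: scaleC_ell2.rep_eq plus_ell2.rep_eq scaleR_ell2.rep_eq complex_eq_iff)

(* C-linearity of a real-linear operator is commutation with multiplication by i. *)
typedef 'a cop = "{K :: 'a ell2 \<Rightarrow>\<^sub>L 'a ell2. \<forall>\<psi>. K (scaleC_ell2 \<i> \<psi>) = scaleC_ell2 \<i> (K \<psi>)}"
  morphisms blinfun_of_cop cop_of_blinfun
  by (rule exI[of _ id_blinfun]) simp

setup_lifting type_definition_cop

definition app :: "'a cop \<Rightarrow> 'a ell2 \<Rightarrow> 'a ell2" where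
  "app K \<psi> = blinfun_of_cop K \<psi>"

lemma app_ii: "app K (scaleC_ell2 \<i> \<psi>) = scaleC_ell2 \<i> (app K \<psi>)"
  using blinfun_of_cop[of K] by (simp add: app_def)

lemma app_add_right: "app K (\<phi> + \<psi>) = app K \<phi> + app K \<psi>"
  by (simp add: app_def blinfun.add_right)

lemma app_scaleR_right: "app K (r *\<^sub>R \<psi>) = r *\<^sub>R app K \<psi>"
  by (simp add: app_def blinfun.scaleR_right)

lemma app_scaleC: "app K (scaleC_ell2 c \<psi>) = scaleC_ell2 c (app K \<psi>)"
  by (simp add: scaleC_ell2_conv[of c] app_add_right app_scaleR_right app_ii)

lemma cop_eqI: "(\<And>\<psi>. app K \<psi> = app L \<psi>) \<Longrightarrow> K = L"
  by (simp add: app_def blinfun_eqI flip: blinfun_of_cop_inject)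

instantiation cop :: (type) real_vector
begin

lift_definition zero_cop :: "'a cop" is 0
  by (simp add: linear_0 bounded_linear.linear[OF bounded_linear_scaleC_ell2])

lift_definition plus_cop :: "'a cop \<Rightarrow> 'a cop \<Rightarrow> 'a cop" is "(+)"
  by (simp add: blinfun.add_left scaleC_ell2_add_right)

lift_definition uminus_cop :: "'a cop \<Rightarrow> 'a cop" is uminus
  by (simp add: blinfun.minus_left linear_neg bounded_linear.linear[OF bounded_linear_scaleC_ell2])

lift_definition minus_cop :: "'a cop \<Rightarrow> 'a cop \<Rightarrow> 'a cop" is "(-)"
  by (simp add: blinfun.diff_left linear_diff bounded_linear.linear[OF bounded_linear_scaleC_ell2])

lift_definition scaleR_cop :: "real \<Rightarrow> 'a cop \<Rightarrow> 'a cop" is scaleR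
  by (simp add: blinfun.scaleR_left scaleC_ell2_scaleR)

instance
  by standard (simp_all add: plus_cop.rep_eq uminus_cop.rep_eq minus_cop.rep_eq zero_cop.rep_eq
      scaleR_cop.rep_eq scaleR_add_left scaleR_add_right flip: blinfun_of_cop_inject)

end

lemma app_zero: "app 0 \<psi> = 0"
  by (simp add: app_def zero_cop.rep_eq)

lemma app_add: "app (K + L) \<psi> = app K \<psi> + app L \<psi>"
  by (simp add: app_def plus_cop.rep_eq blinfun.add_left)

lemma app_uminus: "app (- K) \<psi> = - app K \<psi>"
  by (simp add: app_def uminus_cop.rep_eq blinfun.minus_left)

lemma app_diff: "app (K - L) \<psi> = app K \<psi> - app L \<psi>"
  by (simp add: app_def minus_cop.rep_eq blinfun.diff_left)

lemma app_scaleR: "app (r *\<^sub>R K) \<psi> = r *\<^sub>R app K \<psi>"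
  by (simp add: app_def scaleR_cop.rep_eq blinfun.scaleR_left)

lemma norm_ket: "norm (ket n) = 1"
proof -
  have "(\<Sum>\<^sub>\<infinity>x. (cmod (Rep_ell2 (ket n) x))\<^sup>2) = (\<Sum>\<^sub>\<infinity>x\<in>{n}. (cmod (Rep_ell2 (ket n) x))\<^sup>2)"
    by (rule infsum_cong_neutral) (auto simp: ket.rep_eq)
  then show ?thesis
    by (simp add: norm_ell2_def ket.rep_eq)
qed

text \<open>With composition as product and the operator norm, exponentials, inverses near 1 and
  power series of operators become computations in a normed algebra.\<close>

instantiation cop :: (type) real_normed_algebra_1
begin

lift_definition one_cop :: "'a cop" is id_blinfun
  by simp

lift_definition times_cop :: "'a cop \<Rightarrow> 'a cop \<Rightarrow> 'a cop" is "(o\<^sub>L)"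
  by simp

definition norm_cop :: "'a cop \<Rightarrow> real" where
  "norm_cop K = norm (blinfun_of_cop K)"

definition dist_cop :: "'a cop \<Rightarrow> 'a cop \<Rightarrow> real" where
  "dist_cop K L = norm (K - L)"

definition sgn_cop :: "'a cop \<Rightarrow> 'a cop" where
  "sgn_cop K = inverse (norm K) *\<^sub>R K"

definition uniformity_cop :: "('a cop \<times> 'a cop) filter" where
  "uniformity_cop = (INF e\<in>{0<..}. principal {(K, L). dist K L < e})"

definition open_cop :: "'a cop set \<Rightarrow> bool" where
  "open_cop U \<longleftrightarrow> (\<forall>K\<in>U. eventually (\<lambda>(K', L). K' = K \<longrightarrow> L \<in> U) uniformity)"

instance
proof
  fix K L M :: "'a cop" and r :: real
  show "norm K = 0 \<longleftrightarrow> K = 0"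
    by (simp add: norm_cop_def zero_cop.rep_eq flip: blinfun_of_cop_inject)
  show "norm (K + L) \<le> norm K + norm L"
    by (simp add: norm_cop_def plus_cop.rep_eq norm_triangle_ineq)
  show "norm (r *\<^sub>R K) = \<bar>r\<bar> * norm K"
    by (simp add: norm_cop_def scaleR_cop.rep_eq)
  show "norm (K * L) \<le> norm K * norm L"
    by (simp add: norm_cop_def times_cop.rep_eq norm_blinfun_compose)
  show "norm (1 :: 'a cop) = 1"
  proof (rule antisym)
    show "norm (1 :: 'a cop) \<le> 1"
      by (simp add: norm_cop_def one_cop.rep_eq norm_blinfun_id_le)
    show "1 \<le> norm (1 :: 'a cop)"
      using norm_blinfun[of "blinfun_of_cop (1 :: 'a cop)" "ket undefined"]
      by (simp add: norm_cop_def one_cop.rep_eq norm_ket)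
  qed
  have *: "blinfun_of_cop (K * L) = blinfun_of_cop K o\<^sub>L blinfun_of_cop L" for K L :: "'a cop"
    by (rule times_cop.rep_eq)
  show "K * L * M = K * (L * M)" "(K + L) * M = K * M + L * M" "K * (L + M) = K * L + K * M"
      "1 * K = K" "K * 1 = K" "r *\<^sub>R K * L = r *\<^sub>R (K * L)" "K * r *\<^sub>R L = r *\<^sub>R (K * L)"
    by (auto intro!: blinfun_eqI simp: * plus_cop.rep_eq one_cop.rep_eq scaleR_cop.rep_eq
        blinfun.bilinear_simps simp flip: blinfun_of_cop_inject)
  show "(0 :: 'a cop) \<noteq> 1"
  proof
    assume "(0 :: 'a cop) = 1"
    then have "app (0 :: 'a cop) (ket undefined) = ket undefined"
      by (simp add: app_def one_cop.rep_eq)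
    then show False
      using norm_ket[of "undefined :: 'a"] by (simp add: app_zero)
  qed
qed (auto simp: dist_cop_def sgn_cop_def uniformity_cop_def open_cop_def)

end

lemma app_one: "app 1 \<psi> = \<psi>"
  by (simp add: app_def one_cop.rep_eq)

lemma app_mult: "app (K * L) \<psi> = app K (app L \<psi>)"
  by (simp add: app_def times_cop.rep_eq)

lemma norm_app_le: "norm (app K \<psi>) \<le> norm K * norm \<psi>"
  by (simp add: app_def norm_cop_def norm_blinfun)

lemma bounded_linear_blinfun_of_cop: "bounded_linear blinfun_of_cop"
  by (rule bounded_linear_intro[where K = 1])
    (simp_all add: plus_cop.rep_eq scaleR_cop.rep_eq norm_cop_def)

lemma bounded_linear_app: "bounded_linear (app K)"
  by (rule bounded_linear_intro[where K = "norm K"])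
    (simp_all add: app_add_right app_scaleR_right norm_app_le mult.commute[of _ "norm K"])

lemma bounded_linear_app_left: "bounded_linear (\<lambda>K. app K \<psi>)"
  by (rule bounded_linear_intro[where K = "norm \<psi>"])
    (simp_all add: app_add app_scaleR norm_app_le)

lemma app_sum: "app (\<Sum>i\<in>I. f i) \<psi> = (\<Sum>i\<in>I. app (f i) \<psi>)"
  using bounded_linear.linear[OF bounded_linear_app_left] by (rule linear_sum)

lemma bounded_linear_Rep_ell2: "bounded_linear (\<lambda>\<psi>. Rep_ell2 \<psi> x)"
  by (rule bounded_linear_intro[where K = 1])
    (simp_all add: plus_ell2.rep_eq scaleR_ell2.rep_eq cmod_le_norm_ell2)

lemma Rep_ell2_sum: "Rep_ell2 (\<Sum>i\<in>I. f i) x = (\<Sum>i\<in>I. Rep_ell2 (f i) x)"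
  using bounded_linear.linear[OF bounded_linear_Rep_ell2] by (rule linear_sum)

text \<open>The limit exists among real-linear operators, and commutation with \<open>\<i>\<close>
  survives pointwise limits.\<close>

instance cop :: (type) banach
proof
  fix X :: "nat \<Rightarrow> 'a cop"
  assume X: "Cauchy X"
  have "Cauchy (\<lambda>n. blinfun_of_cop (X n))"
    using X by (rule bounded_linear.Cauchy[OF bounded_linear_blinfun_of_cop])
  then obtain L where L: "(\<lambda>n. blinfun_of_cop (X n)) \<longlonglongrightarrow> L"
    by (auto simp: Cauchy_convergent_iff convergent_def)
  have lim: "(\<lambda>n. app (X n) \<psi>) \<longlonglongrightarrow> L \<psi>" for \<psi>
    unfolding app_def using L by (intro tendsto_intros)
  have "L (scaleC_ell2 \<i> \<psi>) = scaleC_ell2 \<i> (L \<psi>)" for \<psi>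
  proof (rule LIMSEQ_unique)
    show "(\<lambda>n. app (X n) (scaleC_ell2 \<i> \<psi>)) \<longlonglongrightarrow> L (scaleC_ell2 \<i> \<psi>)"
      by (rule lim)
    show "(\<lambda>n. app (X n) (scaleC_ell2 \<i> \<psi>)) \<longlonglongrightarrow> scaleC_ell2 \<i> (L \<psi>)"
      unfolding app_scaleC
      by (rule bounded_linear.tendsto[OF bounded_linear_scaleC_ell2 lim])
  qed
  then have "blinfun_of_cop (cop_of_blinfun L) = L"
    by (simp add: cop_of_blinfun_inverse)
  then have "dist (X n) (cop_of_blinfun L) = dist (blinfun_of_cop (X n)) L" for n
    by (simp add: dist_norm norm_cop_def minus_cop.rep_eq)
  then have "X \<longlonglongrightarrow> cop_of_blinfun L"
    using L by (simp add: lim_sequentially)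
  then show "convergent X"
    by (auto simp: convergent_def)
qed

section \<open>Matrix elements in the canonical basis\<close>

definition mel :: "'a cop \<Rightarrow> 'a \<Rightarrow> 'a \<Rightarrow> complex" where
  "mel K n m = Rep_ell2 (app K (ket m)) n"

text \<open>Subtracting the partial sum over a finite set leaves the restriction of
  \<open>\<psi>\<close> to its complement, whose squared norm is a tail of a convergent sum.\<close>

lemma has_sum_ket: "((\<lambda>l. scaleC_ell2 (Rep_ell2 \<psi> l) (ket l)) has_sum \<psi>) UNIV"
  unfolding has_sum_def
proof (rule tendstoI)
  fix e :: real
  assume e: "0 < e"
  define f where "f = (\<lambda>x. (cmod (Rep_ell2 \<psi> x))\<^sup>2)"
  have summ: "f summable_on UNIV"
    using square_summable_Rep_ell2[of \<psi>] by (simp add: square_summable_def f_def)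
  then have "(sum f \<longlongrightarrow> infsum f UNIV) (finite_subsets_at_top UNIV)"
    using has_sum_infsum has_sum_def by blast
  then have "\<forall>\<^sub>F F in finite_subsets_at_top UNIV. dist (sum f F) (infsum f UNIV) < e\<^sup>2"
    using e by (intro tendstoD) auto
  moreover have "\<forall>\<^sub>F F in finite_subsets_at_top (UNIV :: 'a set). finite F"
    by (simp add: eventually_finite_subsets_at_top_weakI)
  ultimately show "\<forall>\<^sub>F F in finite_subsets_at_top UNIV.
      dist (\<Sum>l\<in>F. scaleC_ell2 (Rep_ell2 \<psi> l) (ket l)) \<psi> < e"
  proof eventually_elim
    case (elim F)
    have Rep: "Rep_ell2 (\<psi> - (\<Sum>l\<in>F. scaleC_ell2 (Rep_ell2 \<psi> l) (ket l))) x
        = (if x \<in> F then 0 else Rep_ell2 \<psi> x)" for x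
    proof -
      have "(\<Sum>l\<in>F. Rep_ell2 \<psi> l * (if x = l then 1 else 0))
          = (\<Sum>l\<in>F. if x = l then Rep_ell2 \<psi> l else 0)"
        by (rule sum.cong) auto
      then show ?thesis
        using elim by (simp add: minus_ell2.rep_eq Rep_ell2_sum scaleC_ell2.rep_eq ket.rep_eq sum.delta)
    qed
    have "(norm (\<psi> - (\<Sum>l\<in>F. scaleC_ell2 (Rep_ell2 \<psi> l) (ket l))))\<^sup>2 = infsum f (UNIV - F)"
      unfolding norm_ell2_power2 Rep f_def by (rule infsum_cong_neutral) auto
    also have "\<dots> = infsum f UNIV - sum f F"
      using elim by (subst infsum_Diff) (auto intro: summ summable_on_finite)
    also have "\<dots> < e\<^sup>2"
      using elim by (simp add: dist_real_def abs_less_iff)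
    finally show ?case
      using e by (metis dist_commute dist_norm power_less_imp_less_base less_imp_le)
  qed
qed

lemma has_sum_app: "((\<lambda>l. Rep_ell2 \<psi> l * mel K n l) has_sum Rep_ell2 (app K \<psi>) n) UNIV"
proof -
  have "bounded_linear (\<lambda>\<psi>. Rep_ell2 (app K \<psi>) n)"
    using bounded_linear_compose[OF bounded_linear_Rep_ell2 bounded_linear_app] .
  from has_sum_bounded_linear[OF this has_sum_ket[of \<psi>]] show ?thesis
    by (simp add: o_def app_scaleC scaleC_ell2.rep_eq mel_def)
qed

text \<open>By continuity an operator is determined by its values on the canonical basis; operator
  identities below are checked entrywise with this rule.\<close>

lemma cop_eqI_mel: "(\<And>n m. mel K n m = mel L n m) \<Longrightarrow> K = L"
  by (intro cop_eqI ell2_eqI has_sum_unique[OF has_sum_app]) (simp add: has_sum_app)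

lemma mel_mult_has_sum: "((\<lambda>l. mel K n l * mel L l m) has_sum mel (K * L) n m) UNIV"
  using has_sum_app[of "app L (ket m)" K n] by (simp add: mel_def app_mult mult.commute)

lemma mel_mult: "mel (K * L) n m = (\<Sum>\<^sub>\<infinity>l. mel K n l * mel L l m)"
  by (simp add: infsumI[OF mel_mult_has_sum])

lemma mel_diff: "mel (K - L) n m = mel K n m - mel L n m"
  by (simp add: mel_def app_diff minus_ell2.rep_eq)

lemma mel_scaleR: "mel (r *\<^sub>R K) n m = r * mel K n m"
  unfolding mel_def app_scaleR scaleR_ell2.rep_eq by (rule scaleR_conv_of_real)

lemma mel_sum: "mel (\<Sum>i\<in>I. f i) n m = (\<Sum>i\<in>I. mel (f i) n m)"
  by (simp add: mel_def app_sum Rep_ell2_sum)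

lemma mel_zero: "mel 0 n m = 0"
  by (simp add: mel_def app_zero zero_ell2.rep_eq)

lemma mel_one: "mel 1 n m = (if n = m then 1 else 0)"
  by (simp add: mel_def app_one ket.rep_eq)

lemma infsum_eq_single:
  fixes f :: "'a \<Rightarrow> 'b::{topological_comm_monoid_add, t2_space}"
  assumes "\<And>x. x \<noteq> a \<Longrightarrow> f x = 0"
  shows "(\<Sum>\<^sub>\<infinity>x. f x) = f a"
proof -
  have "(\<Sum>\<^sub>\<infinity>x. f x) = (\<Sum>\<^sub>\<infinity>x\<in>{a}. f x)"
    by (rule infsum_cong_neutral) (auto simp: assms)
  then show ?thesis by simp
qed

section \<open>Self-adjointness, evolution and commutators with the position operators\<close>

lemma scaleR_complex: "r *\<^sub>R (z :: complex) = complex_of_real r * z"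
  by (rule scaleR_conv_of_real)

lemma app_cop_of_fun:
  assumes "bounded_linear f" "\<And>\<psi>. f (scaleC_ell2 \<i> \<psi>) = scaleC_ell2 \<i> (f \<psi>)"
  shows "app (cop_of_blinfun (Blinfun f)) \<psi> = f \<psi>"
  using assms by (simp add: app_def cop_of_blinfun_inverse bounded_linear_Blinfun_apply)

text \<open>The algebra has only real scalars, so the imaginary unit in the generator
  \<open>- (iop * h)\<close> enters as a central element.\<close>

definition iop :: "'a cop" where
  "iop = cop_of_blinfun (Blinfun (scaleC_ell2 \<i>))"

lemma app_iop: "app iop \<psi> = scaleC_ell2 \<i> \<psi>"
  unfolding iop_def by (rule app_cop_of_fun[OF bounded_linear_scaleC_ell2]) simp

lemma iop_commute: "iop * K = K * iop"
  by (rule cop_eqI) (simp add: app_mult app_iop app_ii)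

lemma norm_app_iop: "norm (app iop \<psi>) = norm \<psi>"
  by (simp add: app_iop norm_scaleC_ell2)

section \<open>Multiplication operators, shifts and the Laplacian\<close>

definition mulop :: "('a \<Rightarrow> real) \<Rightarrow> 'a cop" where
  "mulop U = cop_of_blinfun (mult_op U)"

lemma
  assumes "bounded (range U)"
  shows blinfun_of_mulop: "blinfun_of_cop (mulop U) = mult_op U"
    and Rep_app_mulop: "Rep_ell2 (app (mulop U) \<psi>) n = of_real (U n) * Rep_ell2 \<psi> n"
proof -
  have "mult_op U (scaleC_ell2 \<i> \<phi>) = scaleC_ell2 \<i> (mult_op U \<phi>)" for \<phi>
    by (rule ell2_eqI) (simp add: mult_op_apply[OF assms] scaleC_ell2.rep_eq)
  then show *: "blinfun_of_cop (mulop U) = mult_op U"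
    by (simp add: mulop_def cop_of_blinfun_inverse)
  show "Rep_ell2 (app (mulop U) \<psi>) n = of_real (U n) * Rep_ell2 \<psi> n"
    by (simp add: app_def * mult_op_apply[OF assms])
qed

lemma mel_mulop_mult:
  assumes "bounded (range U)"
  shows "mel (mulop U * K) n m = of_real (U n) * mel K n m"
  by (simp add: mel_def app_mult Rep_app_mulop[OF assms])

lemma mel_mulop:
  assumes "bounded (range U)"
  shows "mel (mulop U) n m = (if n = m then of_real (U n) else 0)"
  using mel_mulop_mult[OF assms, of 1 n m] by (simp add: mel_one)

lemma mel_mult_mulop:
  assumes "bounded (range U)"
  shows "mel (K * mulop U) n m = mel K n m * of_real (U m)"
  unfolding mel_mult mel_mulop[OF assms] by (subst infsum_eq_single[of m]) auto

lemma bij_add_right: "bij (\<lambda>n. n + e)" for e :: "'a::ab_group_add"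
  by (rule o_bij[of "\<lambda>n. n - e"]) (auto simp: fun_eq_iff)

definition shift :: "'a \<Rightarrow> ('a::ab_group_add) cop" where
  "shift e = cop_of_blinfun (Blinfun (\<lambda>\<psi>. Abs_ell2 (\<lambda>n. Rep_ell2 \<psi> (n + e))))"

lemma Rep_app_shift: "Rep_ell2 (app (shift e) \<psi>) n = Rep_ell2 \<psi> (n + e)"
proof -
  define S where "S = (\<lambda>\<phi> :: 'a ell2. Abs_ell2 (\<lambda>n. Rep_ell2 \<phi> (n + e)))"
  have mem: "square_summable (\<lambda>n. Rep_ell2 \<phi> (n + e))" for \<phi> :: "'a ell2"
    using square_summable_Rep_ell2[of \<phi>] unfolding square_summable_def
    using summable_on_reindex_bij_betw[OF bij_add_right[of e], of "\<lambda>n. (cmod (Rep_ell2 \<phi> n))\<^sup>2"] by simp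
  have Rep_S: "Rep_ell2 (S \<phi>) n = Rep_ell2 \<phi> (n + e)" for \<phi> n
    by (simp add: S_def Rep_Abs_ell2[OF mem])
  have "bounded_linear S"
  proof (rule bounded_linear_intro[where K = 1])
    show "S (\<phi> + \<xi>) = S \<phi> + S \<xi>" for \<phi> \<xi>
      by (rule ell2_eqI) (simp add: Rep_S plus_ell2.rep_eq)
    show "S (r *\<^sub>R \<phi>) = r *\<^sub>R S \<phi>" for r \<phi>
      by (rule ell2_eqI) (simp add: Rep_S scaleR_ell2.rep_eq)
    show "norm (S \<phi>) \<le> norm \<phi> * 1" for \<phi>
      using infsum_reindex_bij_betw[OF bij_add_right[of e], of "\<lambda>n. (cmod (Rep_ell2 \<phi> n))\<^sup>2"]
      by (simp add: norm_ell2_def Rep_S)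
  qed
  moreover have "S (scaleC_ell2 \<i> \<phi>) = scaleC_ell2 \<i> (S \<phi>)" for \<phi>
    by (rule ell2_eqI) (simp add: Rep_S scaleC_ell2.rep_eq)
  ultimately have "app (shift e) \<psi> = S \<psi>"
    unfolding shift_def S_def[symmetric] by (rule app_cop_of_fun)
  then show ?thesis
    by (simp add: Rep_S)
qed

text \<open>As a finite sum of shifts, the Laplacian gets its adjoint and its commutators with
  position from those of a single shift.\<close>

definition lapl :: "(int ^ 'd::finite) cop" where
  "lapl = (\<Sum>e | l1_norm e = 1. shift e)"

lemma Rep_app_lapl:
  "Rep_ell2 (app lapl \<psi>) n = (\<Sum>e | l1_norm e = 1. Rep_ell2 \<psi> (n + e))"
  by (simp add: lapl_def app_sum Rep_ell2_sum Rep_app_shift)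

lemma blinfun_of_lapl: "blinfun_of_cop lapl = laplacian"
proof (rule blinfun_eqI, rule ell2_eqI)
  fix \<psi> :: "(int ^ 'd) ell2" and n
  have "(\<Sum>m | l1_norm (n - m) = 1. Rep_ell2 \<psi> m) = (\<Sum>e | l1_norm e = 1. Rep_ell2 \<psi> (n + e))"
  proof (rule sum.reindex_bij_witness[of _ "\<lambda>e. n + e" "\<lambda>m. m - n"])
    show "m - n \<in> {e. l1_norm e = 1}" if "m \<in> {m. l1_norm (n - m) = 1}" for m
      using that l1_norm_minus[of "n - m"] by simp
  qed (auto simp: l1_norm_minus)
  then show "Rep_ell2 (blinfun_of_cop lapl \<psi>) n = Rep_ell2 (laplacian \<psi>) n"
    using Rep_app_lapl[of \<psi> n] by (simp add: app_def laplacian_apply)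
qed

lemma mel_lapl_mult: "mel (lapl * K) n m = (\<Sum>e | l1_norm e = 1. mel K (n + e) m)"
  by (simp add: mel_def app_mult Rep_app_lapl)

section \<open>Adjoint pairs and unitarity\<close>

text \<open>The real inner product suffices: for complex-linear operators, replacing
  \<open>\<phi>\<close> by its multiple by \<open>\<i>\<close> recovers the Hermitian
  relation.\<close>

definition adj :: "'a cop \<Rightarrow> 'a cop \<Rightarrow> bool" where
  "adj K L \<longleftrightarrow> (\<forall>\<phi> \<psi>. inner (app K \<phi>) \<psi> = inner \<phi> (app L \<psi>))"

lemma adjD: "adj K L \<Longrightarrow> inner (app K \<phi>) \<psi> = inner \<phi> (app L \<psi>)"
  by (simp add: adj_def)

lemma adj_mult: "adj K L \<Longrightarrow> adj K' L' \<Longrightarrow> adj (K * K') (L' * L)"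
  by (simp add: adj_def app_mult)

lemma adj_add: "adj K L \<Longrightarrow> adj K' L' \<Longrightarrow> adj (K + K') (L + L')"
  by (simp add: adj_def app_add inner_add_left inner_add_right)

lemma adj_scaleR: "adj K L \<Longrightarrow> adj (r *\<^sub>R K) (r *\<^sub>R L)"
  by (simp add: adj_def app_scaleR)

lemma adj_power: "adj K L \<Longrightarrow> adj (K ^ n) (L ^ n)"
proof (induction n)
  case 0
  then show ?case by (simp add: adj_def app_one)
next
  case (Suc n)
  then show ?case
    using adj_mult[of K L "K ^ n" "L ^ n"] by (simp add: power_commutes)
qed

lemma adj_sums:
  assumes "f sums K" "g sums L" "\<And>n. adj (f n) (g n)"
  shows "adj K L"
  unfolding adj_def
proof (intro allI)
  fix \<phi> \<psi>
  have "(\<lambda>n. inner (app (f n) \<phi>) \<psi>) sums inner (app K \<phi>) \<psi>"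
    using assms(1)
    by (intro bounded_linear.sums[OF bounded_linear_inner_left]
        bounded_linear.sums[OF bounded_linear_app_left])
  moreover have "(\<lambda>n. inner \<phi> (app (g n) \<psi>)) sums inner \<phi> (app L \<psi>)"
    using assms(2)
    by (intro bounded_linear.sums[OF bounded_linear_inner_right]
        bounded_linear.sums[OF bounded_linear_app_left])
  ultimately show "inner (app K \<phi>) \<psi> = inner \<phi> (app L \<psi>)"
    using assms(3) by (simp add: adj_def sums_unique2)
qed

lemma adj_exp: "adj K L \<Longrightarrow> adj (exp K) (exp L)"
  by (rule adj_sums[OF exp_converges exp_converges]) (intro adj_scaleR adj_power)

text \<open>The adjoint of \<open>exp K\<close> is \<open>exp (- K)\<close>, which is also its
  inverse.\<close>

lemma norm_app_exp_skew:
  assumes "adj K (- K)"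
  shows "norm (app (exp K) \<psi>) = norm \<psi>"
proof -
  have "exp (- K) * exp K = 1"
    using exp_minus_inverse[of "- K"] by simp
  then have "inner (app (exp K) \<psi>) (app (exp K) \<psi>) = inner \<psi> \<psi>"
    by (simp add: adjD[OF adj_exp[OF assms]] app_one flip: app_mult)
  then show ?thesis
    by (simp add: norm_eq_sqrt_inner)
qed

lemma adj_iop: "adj iop (- iop)"
  by (simp add: adj_def app_iop app_uminus inner_ell2_def scaleC_ell2.rep_eq uminus_ell2.rep_eq
      inner_complex_def algebra_simps)

lemma adj_mulop: "bounded (range U) \<Longrightarrow> adj (mulop U) (mulop U)"
  by (simp add: adj_def inner_ell2_def Rep_app_mulop inner_complex_def algebra_simps)

lemma adj_shift: "adj (shift e) (shift (- e))"
  unfolding adj_def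
proof (intro allI)
  fix \<phi> \<psi> :: "'a ell2"
  show "inner (app (shift e) \<phi>) \<psi> = inner \<phi> (app (shift (- e)) \<psi>)"
    using infsum_reindex_bij_betw[OF bij_add_right[of e],
        of "\<lambda>n. inner (Rep_ell2 \<phi> n) (Rep_ell2 \<psi> (n - e))"]
    by (simp add: inner_ell2_def Rep_app_shift)
qed

lemma adj_lapl: "adj (lapl :: (int ^ 'd::finite) cop) lapl"
proof -
  have "(\<Sum>e | l1_norm e = 1. inner \<phi> (app (shift (- e)) \<psi>))
      = (\<Sum>e | l1_norm e = 1. inner \<phi> (app (shift e) \<psi>))" for \<phi> \<psi> :: "(int ^ 'd) ell2"
    by (rule sum.reindex_bij_witness[of _ uminus uminus]) (auto simp: l1_norm_minus)
  then show ?thesis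
    by (simp add: adj_def lapl_def app_sum inner_sum_left inner_sum_right adjD[OF adj_shift])
qed

section \<open>Exponentials and the time evolution\<close>

lemma exp_intertwine:
  fixes a b s :: "'a::{real_normed_algebra_1,banach}"
  assumes "a * s = s * b"
  shows "exp a * s = s * exp b"
proof -
  have pow: "a ^ n * s = s * b ^ n" for n
  proof (induction n)
    case (Suc n)
    have "a ^ Suc n * s = a * s * b ^ n"
      by (simp add: mult.assoc Suc)
    also have "\<dots> = s * b ^ Suc n"
      by (simp add: assms mult.assoc)
    finally show ?case .
  qed simp
  have "(\<lambda>n. a ^ n /\<^sub>R fact n * s) sums (exp a * s)"
    by (intro sums_mult2 exp_converges)
  moreover have "(\<lambda>n. s * (b ^ n /\<^sub>R fact n)) sums (s * exp b)"
    by (intro sums_mult exp_converges)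
  ultimately show ?thesis
    by (simp add: pow sums_unique2)
qed

text \<open>Both sides are the same power series term by term; from here on the evolution is an
  exponential in the algebra.\<close>

lemma evolution_eq_exp: "evolution (blinfun_of_cop K) t \<psi> = app (exp (t *\<^sub>R - (iop * K))) \<psi>"
proof -
  define A where "A = t *\<^sub>R - (iop * K)"
  have "blinfun_of_cop A = op_scaleC (- \<i> * complex_of_real t) (blinfun_of_cop K)"
  proof (rule blinfun_eqI)
    fix \<phi>
    have "app A \<phi> = scaleC_ell2 (- \<i> * complex_of_real t) (app K \<phi>)"
      by (rule ell2_eqI) (simp add: A_def app_scaleR app_uminus app_mult app_iop
          scaleC_ell2.rep_eq scaleR_ell2.rep_eq uminus_ell2.rep_eq scaleR_complex)
    then show "blinfun_of_cop A \<phi> = op_scaleC (- \<i> * complex_of_real t) (blinfun_of_cop K) \<phi>"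
      by (simp add: op_scaleC_apply app_def)
  qed
  moreover have "blinfun_of_cop (A ^ n) = op_power (blinfun_of_cop A) n" for n
    by (induction n) (simp_all add: one_cop.rep_eq times_cop.rep_eq)
  then have "(\<lambda>n. (1 / fact n) *\<^sub>R op_power (blinfun_of_cop A) n) sums blinfun_of_cop (exp A)"
    using bounded_linear.sums[OF bounded_linear_blinfun_of_cop exp_converges[of A]]
    by (simp add: scaleR_cop.rep_eq divide_inverse)
  ultimately show ?thesis
    unfolding A_def[symmetric] by (simp add: evolution_def op_exp_def sums_iff app_def)
qed

section \<open>Commutators with the position operators\<close>

text \<open>The graph of the \<open>i\<close>-th position operator; a relation fits since the
  operator is unbounded, and existence of \<open>\<xi>\<close> says that \<open>\<psi>\<close> is in
  its domain.\<close>

definition pos_rel :: "'d::finite \<Rightarrow> (int ^ 'd) ell2 \<Rightarrow> (int ^ 'd) ell2 \<Rightarrow> bool" where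
  "pos_rel i \<psi> \<xi> \<longleftrightarrow> (\<forall>x. Rep_ell2 \<xi> x = of_int (x $ i) * Rep_ell2 \<psi> x)"

lemma position_eqI:
  assumes "\<And>i. pos_rel i \<psi> (\<xi> i)"
  shows "position \<psi> = (\<chi> i. \<xi> i)"
proof (rule vec_eq_iff[THEN iffD2], rule allI)
  fix i
  have "(\<lambda>x. of_int (x $ i) * Rep_ell2 \<psi> x) = Rep_ell2 (\<xi> i)"
    using assms[of i] by (simp add: pos_rel_def fun_eq_iff)
  then show "position \<psi> $ i = (\<chi> i. \<xi> i) $ i"
    by (simp add: position_def Rep_ell2_inverse)
qed

lemma position_domain_obtain:
  assumes "\<psi> \<in> position_domain"
  obtains \<xi> where "\<And>i. pos_rel i \<psi> (\<xi> i)"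
proof
  show "pos_rel i \<psi> (Abs_ell2 (\<lambda>x. of_int (x $ i) * Rep_ell2 \<psi> x))" for i
    using assms by (simp add: pos_rel_def position_domain_def Rep_Abs_ell2)
qed

lemma pos_rel_add: "pos_rel i \<psi> \<xi> \<Longrightarrow> pos_rel i \<psi>' \<xi>' \<Longrightarrow> pos_rel i (\<psi> + \<psi>') (\<xi> + \<xi>')"
  by (simp add: pos_rel_def plus_ell2.rep_eq distrib_left)

lemma pos_rel_scaleR: "pos_rel i \<psi> \<xi> \<Longrightarrow> pos_rel i (r *\<^sub>R \<psi>) (r *\<^sub>R \<xi>)"
  by (simp add: pos_rel_def scaleR_ell2.rep_eq)

lemma pos_rel_ket: "pos_rel i (ket m) (of_int (m $ i) *\<^sub>R ket m)"
  by (simp add: pos_rel_def scaleR_ell2.rep_eq ket.rep_eq scaleR_complex)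

lemma ket_in_position_domain: "ket m \<in> position_domain"
proof -
  have "(\<lambda>x. of_int (x $ i) * Rep_ell2 (ket m) x) = Rep_ell2 (of_int (m $ i) *\<^sub>R ket m)" for i
    using pos_rel_ket[of i m] by (simp add: pos_rel_def fun_eq_iff)
  then show ?thesis
    by (simp add: position_domain_def square_summable_Rep_ell2)
qed

(* posc i K L: K preserves the domain of the i-th position operator X and L = [X, K] there. *)
definition posc :: "'d::finite \<Rightarrow> (int ^ 'd) cop \<Rightarrow> (int ^ 'd) cop \<Rightarrow> bool" where
  "posc i K L \<longleftrightarrow> (\<forall>\<psi> \<xi>. pos_rel i \<psi> \<xi> \<longrightarrow> pos_rel i (app K \<psi>) (app K \<xi> + app L \<psi>))"

lemma poscD: "posc i K L \<Longrightarrow> pos_rel i \<psi> \<xi> \<Longrightarrow> pos_rel i (app K \<psi>) (app K \<xi> + app L \<psi>)"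
  by (simp add: posc_def)

text \<open>\<open>ket m\<close> is an eigenvector of the position operator with eigenvalue
  \<open>m $ i\<close>. In particular the kernel of \<open>K\<close> determines
  \<open>L\<close>.\<close>

lemma mel_posc:
  assumes "posc i K L"
  shows "mel L n m = of_int (n $ i - m $ i) * mel K n m"
  using poscD[OF assms pos_rel_ket[of i m]]
  by (simp add: pos_rel_def mel_def app_scaleR_right plus_ell2.rep_eq scaleR_ell2.rep_eq
      scaleR_complex algebra_simps)

lemma posc_unique: "posc i K L \<Longrightarrow> posc i K L' \<Longrightarrow> L = L'"
  by (rule cop_eqI_mel) (simp add: mel_posc)

lemma posc_add: "posc i K L \<Longrightarrow> posc i K' L' \<Longrightarrow> posc i (K + K') (L + L')"
  unfolding posc_def
proof (intro allI impI)
  fix \<psi> \<xi>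
  assume "\<forall>\<psi> \<xi>. pos_rel i \<psi> \<xi> \<longrightarrow> pos_rel i (app K \<psi>) (app K \<xi> + app L \<psi>)"
    and "\<forall>\<psi> \<xi>. pos_rel i \<psi> \<xi> \<longrightarrow> pos_rel i (app K' \<psi>) (app K' \<xi> + app L' \<psi>)"
    and "pos_rel i \<psi> \<xi>"
  then have "pos_rel i (app K \<psi> + app K' \<psi>) (app K \<xi> + app L \<psi> + (app K' \<xi> + app L' \<psi>))"
    by (intro pos_rel_add) auto
  then show "pos_rel i (app (K + K') \<psi>) (app (K + K') \<xi> + app (L + L') \<psi>)"
    by (simp add: app_add add_ac)
qed

lemma posc_scaleR: "posc i K L \<Longrightarrow> posc i (r *\<^sub>R K) (r *\<^sub>R L)"
  unfolding posc_def app_scaleR by (simp add: pos_rel_scaleR flip: scaleR_add_right)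

lemma posc_mult: "posc i K L \<Longrightarrow> posc i K' L' \<Longrightarrow> posc i (K * K') (L * K' + K * L')"
  unfolding posc_def
proof (intro allI impI)
  fix \<psi> \<xi>
  assume K: "\<forall>\<psi> \<xi>. pos_rel i \<psi> \<xi> \<longrightarrow> pos_rel i (app K \<psi>) (app K \<xi> + app L \<psi>)"
    and "\<forall>\<psi> \<xi>. pos_rel i \<psi> \<xi> \<longrightarrow> pos_rel i (app K' \<psi>) (app K' \<xi> + app L' \<psi>)"
    and "pos_rel i \<psi> \<xi>"
  then have "pos_rel i (app K' \<psi>) (app K' \<xi> + app L' \<psi>)"
    by blast
  with K have "pos_rel i (app K (app K' \<psi>)) (app K (app K' \<xi> + app L' \<psi>) + app L (app K' \<psi>))"
    by blast
  then show "pos_rel i (app (K * K') \<psi>) (app (K * K') \<xi> + app (L * K' + K * L') \<psi>)"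
    by (simp add: app_add app_mult app_add_right add_ac)
qed

lemma posc_one: "posc i 1 0"
  by (simp add: posc_def app_one app_zero)

lemma posc_zero: "posc i 0 0"
  by (simp add: posc_def app_zero pos_rel_def zero_ell2.rep_eq)

lemma posc_iop: "posc i iop 0"
  by (simp add: posc_def app_zero app_iop pos_rel_def scaleC_ell2.rep_eq)

lemma posc_mulop: "bounded (range U) \<Longrightarrow> posc i (mulop U) 0"
  by (simp add: posc_def app_zero pos_rel_def Rep_app_mulop)

text \<open>\<open>shift e\<close> sends \<open>ket m\<close> to \<open>ket (m - e)\<close>, hence
  the minus sign.\<close>

lemma posc_shift: "posc i (shift e) (- of_int (e $ i) *\<^sub>R shift e)"
  unfolding posc_def pos_rel_def
  by (simp add: Rep_app_shift app_scaleR scaleR_ell2.rep_eq plus_ell2.rep_eq scaleR_complex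
      algebra_simps del: scaleR_minus_left)

text \<open>This is closedness of the position operator: evaluated at a site, the defining identity
  is continuous in both operators.\<close>

lemma posc_sums:
  assumes "f sums K" "g sums L" "\<And>n. posc i (f n) (g n)"
  shows "posc i K L"
  unfolding posc_def pos_rel_def
proof (intro allI impI)
  fix \<psi> \<xi> x
  assume "\<forall>x. Rep_ell2 \<xi> x = of_int (x $ i) * Rep_ell2 \<psi> x"
  then have eq: "Rep_ell2 (app (f n) \<xi> + app (g n) \<psi>) x = of_int (x $ i) * Rep_ell2 (app (f n) \<psi>) x" for n
    using assms(3)[of n] by (simp add: posc_def pos_rel_def)
  note app = bounded_linear.sums[OF bounded_linear_app_left]
  have "(\<lambda>n. Rep_ell2 (app (f n) \<xi> + app (g n) \<psi>) x) sums Rep_ell2 (app K \<xi> + app L \<psi>) x"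
    by (intro bounded_linear.sums[OF bounded_linear_Rep_ell2] sums_add app assms)
  moreover have "(\<lambda>n. of_int (x $ i) * Rep_ell2 (app (f n) \<psi>) x)
      sums (of_int (x $ i) * Rep_ell2 (app K \<psi>) x)"
    by (intro sums_mult bounded_linear.sums[OF bounded_linear_Rep_ell2] app assms)
  ultimately show "Rep_ell2 (app K \<xi> + app L \<psi>) x = of_int (x $ i) * Rep_ell2 (app K \<psi>) x"
    unfolding eq by (rule sums_unique2)
qed

lemma posc_power:
  assumes "posc i K L" "L * K = K * L"
  shows "posc i (K ^ Suc n) (of_nat (Suc n) *\<^sub>R (K ^ n * L))"
proof (induction n)
  case 0
  then show ?case using assms by simp
next
  case (Suc n)
  have "L * K ^ Suc n = K ^ Suc n * L"
    using assms(2) by (metis power_commuting_commutes)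
  then have "L * K ^ Suc n + K * (of_nat (Suc n) *\<^sub>R (K ^ n * L))
      = 1 *\<^sub>R (K ^ Suc n * L) + of_nat (Suc n) *\<^sub>R (K ^ Suc n * L)"
    by (simp add: mult.assoc)
  then have eq: "L * K ^ Suc n + K * (of_nat (Suc n) *\<^sub>R (K ^ n * L))
      = of_nat (Suc (Suc n)) *\<^sub>R (K ^ Suc n * L)"
    by (simp only: flip: scaleR_add_left) simp
  show ?case
    using posc_mult[OF assms(1) Suc] unfolding eq by simp
qed

text \<open>Because \<open>L\<close> commutes with \<open>K\<close>, the Leibniz rule differentiates
  the exponential series like a scalar one.\<close>

lemma posc_exp:
  assumes "posc i K L" "L * K = K * L"
  shows "posc i (exp K) (exp K * L)"
proof -
  define f where "f = (\<lambda>n. K ^ n /\<^sub>R fact n)"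
  \<comment> \<open>The commutator of the term of index \<open>Suc n\<close> is the term of index
    \<open>n\<close> times \<open>L\<close>; the constant term contributes 0, so the series is
    shifted by one.\<close>
  define g where "g = (\<lambda>n. case n of 0 \<Rightarrow> 0 | Suc n \<Rightarrow> (K ^ n /\<^sub>R fact n) * L)"
  have "posc i (f n) (g n)" for n
  proof (cases n)
    case 0
    then show ?thesis by (simp add: f_def g_def posc_one)
  next
    case (Suc k)
    have "inverse (fact (Suc k)) * real (Suc k) = inverse (fact k)"
      by (simp add: field_simps del: of_nat_Suc)
    then show ?thesis
      using posc_scaleR[OF posc_power[OF assms, of k], of "inverse (fact n)"]
      by (simp add: f_def g_def Suc del: of_nat_Suc fact_Suc power_Suc)
  qed
  moreover have "f sums exp K"
    unfolding f_def by (rule exp_converges)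
  moreover have "(\<lambda>n. g (Suc n)) sums (exp K * L)"
    using sums_mult2[OF exp_converges[of K], of L] by (simp add: g_def)
  then have "g sums (exp K * L)"
    using sums_Suc_iff[of g] by (simp add: g_def)
  ultimately show ?thesis
    using posc_sums by blast
qed

section \<open>Joint bounds for operators and their commutators\<close>

text \<open>The sum of the norms of \<open>K\<close> and of its commutator with position is
  submultiplicative by the Leibniz rule, so one estimate controls both.\<close>

definition bnd :: "'d::finite \<Rightarrow> (int ^ 'd) cop \<Rightarrow> real \<Rightarrow> bool" where
  "bnd i K b \<longleftrightarrow> (\<exists>L. posc i K L \<and> norm K + norm L \<le> b)"

lemma bnd_nonneg: "bnd i K b \<Longrightarrow> 0 \<le> b"
  unfolding bnd_def by (meson add_nonneg_nonneg norm_ge_zero order_trans)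

lemma bnd_norm: "bnd i K b \<Longrightarrow> norm K \<le> b"
  unfolding bnd_def by (metis add_increasing2 add_le_cancel_left norm_ge_zero order_trans add.right_neutral)

lemma bnd_mono: "bnd i K b \<Longrightarrow> b \<le> b' \<Longrightarrow> bnd i K b'"
  unfolding bnd_def by (meson order_trans)

lemma bnd_one: "bnd i 1 1"
  unfolding bnd_def using posc_one by force

lemma bnd_zero: "bnd i 0 0"
  unfolding bnd_def using posc_zero by force

lemma bnd_add:
  assumes "bnd i K a" "bnd i L b"
  shows "bnd i (K + L) (a + b)"
proof -
  obtain K' L' where "posc i K K'" "norm K + norm K' \<le> a" "posc i L L'" "norm L + norm L' \<le> b"
    using assms unfolding bnd_def by blast
  then show ?thesis
    unfolding bnd_def using posc_add norm_triangle_ineq[of K L] norm_triangle_ineq[of K' L']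
    by (intro exI[of _ "K' + L'"]) fastforce
qed

lemma bnd_scaleR:
  assumes "bnd i K a"
  shows "bnd i (r *\<^sub>R K) (\<bar>r\<bar> * a)"
proof -
  obtain K' where "posc i K K'" "norm K + norm K' \<le> a"
    using assms unfolding bnd_def by blast
  then show ?thesis
    unfolding bnd_def using posc_scaleR
    by (intro exI[of _ "r *\<^sub>R K'"]) (auto simp: mult_left_mono simp flip: distrib_left)
qed

lemma bnd_mult:
  assumes "bnd i K a" "bnd i L b"
  shows "bnd i (K * L) (a * b)"
proof -
  obtain K' L' where *: "posc i K K'" "norm K + norm K' \<le> a" "posc i L L'" "norm L + norm L' \<le> b"
    using assms unfolding bnd_def by blast
  have "norm (K * L) + norm (K' * L + K * L') \<le> norm K * norm L + (norm K' * norm L + norm K * norm L')"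
    by (intro add_mono norm_triangle_le norm_mult_ineq)
  also have "\<dots> \<le> (norm K + norm K') * (norm L + norm L')"
    by (simp add: algebra_simps)
  also have "\<dots> \<le> a * b"
    using * bnd_nonneg[OF assms(1)] by (intro mult_mono) auto
  finally show ?thesis
    unfolding bnd_def using posc_mult[OF *(1,3)] by blast
qed

lemma bnd_sum: "(\<And>x. x \<in> I \<Longrightarrow> bnd i (f x) (g x)) \<Longrightarrow> bnd i (\<Sum>x\<in>I. f x) (\<Sum>x\<in>I. g x)"
  by (induction I rule: infinite_finite_induct) (auto intro: bnd_zero bnd_add)

lemma bnd_power: "bnd i K a \<Longrightarrow> bnd i (K ^ n) (a ^ n)"
  by (induction n) (auto intro: bnd_one bnd_mult)

lemma bnd_mulop: "bounded (range U) \<Longrightarrow> bnd i (mulop U) (norm (mulop U))"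
  unfolding bnd_def using posc_mulop by force

lemma bnd_lapl: "\<exists>b\<ge>1. bnd i lapl b"
proof -
  have "\<exists>L. posc i (shift e) L \<and> norm (shift e) + norm L \<le> norm (shift e) + norm (- of_int (e $ i) *\<^sub>R shift e)" for e
    using posc_shift by blast
  then have "bnd i lapl (\<Sum>e | l1_norm e = 1. norm (shift e) + norm (- of_int (e $ i) *\<^sub>R shift e))"
    unfolding lapl_def by (intro bnd_sum) (auto simp: bnd_def)
  then show ?thesis
    by (meson bnd_mono max.cobounded1 max.cobounded2)
qed

text \<open>\<open>g\<close> dominates the terms and their commutators alike, so both series
  converge absolutely and closedness applies.\<close>

lemma bnd_suminf:
  assumes "\<And>k. bnd i (f k) (g k)" "summable g"
  shows "bnd i (suminf f) (suminf g)"
proof -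
  obtain L where L: "\<And>k. posc i (f k) (L k)" "\<And>k. norm (f k) + norm (L k) \<le> g k"
    using assms(1) unfolding bnd_def by metis
  have nf: "norm (f k) \<le> g k" and nL: "norm (L k) \<le> g k" for k
    using L(2)[of k] norm_ge_zero[of "f k"] norm_ge_zero[of "L k"] by linarith+
  have sf: "summable (\<lambda>k. norm (f k))"
    by (rule summable_comparison_test'[OF assms(2), of 0]) (use nf in auto)
  have sL: "summable (\<lambda>k. norm (L k))"
    by (rule summable_comparison_test'[OF assms(2), of 0]) (use nL in auto)
  have "norm (suminf f) + norm (suminf L) \<le> (\<Sum>k. norm (f k)) + (\<Sum>k. norm (L k))"
    by (intro add_mono summable_norm sf sL)
  also have "\<dots> = (\<Sum>k. norm (f k) + norm (L k))"
    by (rule suminf_add[OF sf sL])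
  also have "\<dots> \<le> suminf g"
    by (intro suminf_le L summable_add sf sL assms)
  finally show ?thesis
    unfolding bnd_def using sf sL
    by (intro exI[of _ "suminf L"] conjI posc_sums[OF summable_sums summable_sums L(1)])
      (auto intro: summable_norm_cancel)
qed

lemma neumann:
  fixes x :: "'a::{real_normed_algebra_1,banach}"
  assumes "norm x < 1"
  shows "(1 - x) * (\<Sum>n. x ^ n) = 1" "(\<Sum>n. x ^ n) * (1 - x) = 1"
proof -
  have s: "summable (\<lambda>n. x ^ n)"
    using assms by (rule complete_algebra_summable_geometric)
  have *: "(\<Sum>n. x ^ n) = 1 + (\<Sum>n. x ^ Suc n)"
    using suminf_split_head[OF s] by simp
  have "x * (\<Sum>n. x ^ n) = (\<Sum>n. x ^ Suc n)"
    using suminf_mult[OF s, of x] by simp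
  then show "(1 - x) * (\<Sum>n. x ^ n) = 1"
    using * by (simp add: left_diff_distrib)
  have "(\<Sum>n. x ^ n) * x = (\<Sum>n. x ^ Suc n)"
    using suminf_mult2[OF s, of x] by (simp add: power_commutes)
  then show "(\<Sum>n. x ^ n) * (1 - x) = 1"
    using * by (simp add: right_diff_distrib)
qed

section \<open>Block diagonalization of a periodic Schroedinger operator\<close>

lemma mel_mult_eq_0I: "(\<And>l. mel K n l * mel L l m = 0) \<Longrightarrow> mel (K * L) n m = 0"
  unfolding mel_mult by (rule infsum_0)

section \<open>Distances on the lattice\<close>

lemma l1_norm_axis: "l1_norm (axis i a) = \<bar>a\<bar>"
proof -
  have "l1_norm (axis i a) = (\<Sum>j\<in>UNIV. if j = i then \<bar>a\<bar> else 0)"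
    unfolding l1_norm_def by (rule sum.cong) (auto simp: axis_def)
  then show ?thesis by simp
qed

lemma l1_norm_triangle: "l1_norm (n - m) \<le> l1_norm (n - l) + l1_norm (l - m)"
  unfolding l1_norm_def by (simp add: sum_mono flip: sum.distrib)

lemma abs_component_le_l1_norm: "\<bar>n $ i\<bar> \<le> l1_norm n"
  unfolding l1_norm_def using member_le_sum[of i UNIV "\<lambda>i. \<bar>n $ i\<bar>"] by auto

text \<open>With \<open>s\<close> the off-axis part of \<open>e\<close>, the hypotheses read
  \<open>\<bar>e $ i\<bar> + s = 1\<close> and
  \<open>\<bar>e $ i - int (Suc k)\<bar> + s \<le> int k\<close>; any step other than the one
  straight ahead leaves a distance above \<open>k\<close>.\<close>

lemma unit_step_eq_axis:
  assumes "l1_norm e = 1" "l1_norm (e - axis i (int (Suc k))) \<le> int k"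
  shows "e = axis i 1"
proof -
  define s where "s = (\<Sum>j\<in>UNIV - {i}. \<bar>e $ j\<bar>)"
  have s: "0 \<le> s"
    by (simp add: s_def sum_nonneg)
  have e: "\<bar>e $ i\<bar> + s = 1"
    using assms(1) unfolding l1_norm_def s_def by (subst (asm) sum.remove[of _ i]) auto
  have "\<bar>e $ i - int (Suc k)\<bar> + (\<Sum>j\<in>UNIV - {i}. \<bar>(e - axis i (int (Suc k))) $ j\<bar>) \<le> int k"
    using assms(2) unfolding l1_norm_def
    by (subst (asm) sum.remove[of _ i]) (auto simp: axis_def)
  moreover have "(\<Sum>j\<in>UNIV - {i}. \<bar>(e - axis i (int (Suc k))) $ j\<bar>) = s"
    unfolding s_def by (rule sum.cong) (auto simp: axis_def)
  ultimately have "e $ i = 1" "s = 0"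
    using s e by auto
  moreover from this have "e $ j = 0" if "j \<noteq> i" for j
    using that unfolding s_def by (subst (asm) sum_nonneg_eq_0_iff) auto
  ultimately show ?thesis
    by (auto simp: vec_eq_iff axis_def)
qed

section \<open>A Catalan majorant\<close>

text \<open>The pairs with \<open>a + b \<le> K\<close> lie in the square of side \<open>K\<close>,
  and all terms are nonnegative.\<close>

lemma sum_triangle_le_square:
  fixes f :: "nat \<Rightarrow> real"
  assumes "\<And>k. 0 \<le> f k"
  shows "(\<Sum>k\<le>K. \<Sum>a\<le>k. f a * f (k - a)) \<le> (\<Sum>k\<le>K. f k)\<^sup>2"
proof -
  have "(\<Sum>k\<le>K. \<Sum>a\<le>k. f a * f (k - a)) = (\<Sum>(a, b) | a + b \<le> K. f a * f b)"
    unfolding sum.triangle_reindex_eq by simp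
  also have "\<dots> \<le> (\<Sum>(a, b)\<in>{..K} \<times> {..K}. f a * f b)"
    by (rule sum_mono2) (auto intro: assms mult_nonneg_nonneg)
  also have "\<dots> = (\<Sum>k\<le>K. f k)\<^sup>2"
    by (simp add: power2_eq_square sum_product sum.cartesian_product)
  finally show ?thesis .
qed

text \<open>The value is \<open>M ^ k\<close> times the \<open>k\<close>-th Catalan number.\<close>

fun catalan :: "real \<Rightarrow> nat \<Rightarrow> real" where
  "catalan M 0 = 1"
| "catalan M (Suc k) = M * (\<Sum>a\<le>k. catalan M a * catalan M (k - a))"

lemma catalan_nonneg: "0 \<le> M \<Longrightarrow> 0 \<le> catalan M k"
  by (induction M k rule: catalan.induct) (auto intro!: mult_nonneg_nonneg sum_nonneg)

(* The generating function c satisfies c = 1 + M x c^2, so its partial sums stay below 2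
   at x = 1 / (4 M). *)
lemma catalan_le:
  assumes "0 < M"
  shows "catalan M k \<le> 2 * (4 * M) ^ k"
proof -
  define x where "x = 1 / (4 * M)"
  define f where "f = (\<lambda>k. catalan M k * x ^ k)"
  have x: "0 < x" and Mx: "M * x = 1 / 4"
    using assms by (auto simp: x_def)
  have f: "0 \<le> f k" for k
    using catalan_nonneg[of M k] assms x by (simp add: f_def)
  have fSuc: "f (Suc k) = M * x * (\<Sum>a\<le>k. f a * f (k - a))" for k
  proof -
    have "x ^ k = x ^ a * x ^ (k - a)" if "a \<le> k" for a
      using that by (simp flip: power_add)
    then have "(\<Sum>a\<le>k. catalan M a * catalan M (k - a)) * x ^ k = (\<Sum>a\<le>k. f a * f (k - a))"
      unfolding sum_distrib_right f_def by (intro sum.cong) (auto simp: ac_simps)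
    then show ?thesis
      by (simp add: f_def ac_simps)
  qed
  have le2: "(\<Sum>k\<le>K. f k) \<le> 2" for K
  proof (induction K)
    case 0
    then show ?case by (simp add: f_def)
  next
    case (Suc K)
    have "(\<Sum>k\<le>Suc K. f k) = 1 + (\<Sum>k\<le>K. M * x * (\<Sum>a\<le>k. f a * f (k - a)))"
      by (subst sum.atMost_Suc_shift) (simp add: fSuc, simp add: f_def)
    also have "\<dots> = 1 + (1 / 4) * (\<Sum>k\<le>K. \<Sum>a\<le>k. f a * f (k - a))"
      by (simp only: Mx flip: sum_distrib_left)
    also have "\<dots> \<le> 1 + (1 / 4) * (\<Sum>k\<le>K. f k)\<^sup>2"
      using sum_triangle_le_square[of f K] f by simp
    \<comment> \<open>The bound 2 is the fixed point of the map taking \<open>y\<close> to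
      \<open>1 + y^2 / 4\<close>, so the induction closes exactly.\<close>
    also have "\<dots> \<le> 1 + (1 / 4) * 2\<^sup>2"
      by (intro add_left_mono mult_left_mono power_mono Suc sum_nonneg f) auto
    finally show ?case by simp
  qed
  have "f k \<le> (\<Sum>k\<le>k. f k)"
    by (rule member_le_sum) (auto intro: f)
  with le2[of k] have "f k \<le> 2"
    by linarith
  then show ?thesis
    using assms by (simp add: f_def x_def field_simps)
qed

text \<open>What remains of periodicity and non-degeneracy: finitely many spectral projections of
  \<open>V\<close>, one for each class of sites modulo the periods.\<close>

locale periodic_potential =
  fixes p :: "nat ^ 'd::finite" and V :: "int ^ 'd \<Rightarrow> real"
  assumes finite_range: "finite (range V)"
    and V_eq_iff: "V n = V m \<longleftrightarrow> (\<forall>i. int (p $ i) dvd (n - m) $ i)"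
begin

lemma bounded_range: "bounded (range (\<lambda>n. f (V n) :: real))"
  using finite_imp_bounded[OF finite_imageI[OF finite_range, of f]] by (simp add: image_image)

definition proj :: "real \<Rightarrow> (int ^ 'd) cop" where
  "proj v = mulop (\<lambda>n. of_bool (V n = v))"

text \<open>A finite sum of products, unlike an entrywise definition, is bounded at once and
  inherits commutator bounds; \<open>mel_diag\<close> recovers the kernel.\<close>

definition diag :: "(int ^ 'd) cop \<Rightarrow> (int ^ 'd) cop" where
  "diag K = (\<Sum>v\<in>range V. proj v * K * proj v)"

(* The off-diagonal inverse of the commutator with V; the terms with v = w vanish
   because 1 / 0 = 0. *)
definition invad :: "(int ^ 'd) cop \<Rightarrow> (int ^ 'd) cop" where
  "invad K = (\<Sum>v\<in>range V. \<Sum>w\<in>range V. (1 / (v - w)) *\<^sub>R (proj v * K * proj w))"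

lemma mel_proj_mult_proj:
  "mel (proj v * K * proj w) n m = of_bool (V n = v) * (of_bool (V m = w) * mel K n m)"
proof -
  have "bounded (range (\<lambda>n. of_bool (V n = u) :: real))" for u
    using bounded_range[of "\<lambda>x. of_bool (x = u)"] .
  then show ?thesis
    by (simp add: proj_def mel_mult_mulop mel_mulop_mult)
qed

lemma of_bool_sum_range:
  "(\<Sum>v\<in>range V. of_bool (V n = v) * f v) = (f (V n) :: 'b::semiring_1)"
proof -
  have "(\<Sum>v\<in>range V. of_bool (V n = v) * f v) = (\<Sum>v\<in>range V. if v = V n then f v else 0)"
    by (rule sum.cong) auto
  then show ?thesis
    by (simp add: finite_range)
qed

lemma mel_diag: "mel (diag K) n m = of_bool (V n = V m) * mel K n m"
  by (simp add: diag_def mel_sum mel_proj_mult_proj of_bool_sum_range eq_commute[of "V m"])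

lemma mel_invad: "mel (invad K) n m = of_real (1 / (V n - V m)) * mel K n m"
proof -
  have "mel (invad K) n m
      = (\<Sum>v\<in>range V. of_bool (V n = v) * (\<Sum>w\<in>range V. of_bool (V m = w) * (of_real (1 / (v - w)) * mel K n m)))"
    unfolding invad_def mel_sum mel_scaleR mel_proj_mult_proj sum_distrib_left
    by (intro sum.cong refl) (simp add: ac_simps)
  then show ?thesis
    by (simp only: of_bool_sum_range)
qed

section \<open>The recursion for the conjugation and the block diagonal part\<close>

text \<open>Comparing coefficients in \<open>mulop V * s - s * mulop V = \<epsilon> *\<^sub>R (s * b
  - lapl * s)\<close> prescribes the commutator of \<open>V\<close> with \<open>S (Suc k)\<close>;
  \<open>invad\<close> picks the solution without block diagonal part.\<close>

fun S :: "nat \<Rightarrow> (int ^ 'd) cop" where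
  "S 0 = 1"
| "S (Suc k) = invad ((\<Sum>a\<le>k. S a * diag (lapl * S (k - a))) - lapl * S k)"

text \<open>This choice removes the block diagonal part of the prescribed commutator, which is the
  solvability condition.\<close>

definition B :: "nat \<Rightarrow> (int ^ 'd) cop" where
  "B k = diag (lapl * S k)"

lemma S_Suc: "S (Suc k) = invad ((\<Sum>a\<le>k. S a * B (k - a)) - lapl * S k)"
  by (simp add: B_def)

declare S.simps(2) [simp del]

lemma mel_B_eq_0: "V n \<noteq> V m \<Longrightarrow> mel (B k) n m = 0"
  by (simp add: B_def mel_diag)

lemma mel_S_Suc_eq_0: "V n = V m \<Longrightarrow> mel (S (Suc k)) n m = 0"
  by (simp add: S_Suc mel_invad)

text \<open>\<open>B b\<close> stays within a class and \<open>S a\<close> leaves it, so no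
  intermediate site contributes.\<close>

lemma mel_S_mult_B_eq_0:
  assumes "V n = V m" "0 < a"
  shows "mel (S a * B b) n m = 0"
proof (rule mel_mult_eq_0I)
  fix l
  show "mel (S a) n l * mel (B b) l m = 0"
    using assms mel_B_eq_0[of l m b] mel_S_Suc_eq_0[of n l "a - 1"] by (cases "V l = V m") auto
qed

text \<open>On the block diagonal the left side vanishes, and on the right only \<open>a = 0\<close>
  survives, where \<open>B k\<close> cancels \<open>lapl * S k\<close>. Elsewhere the commutator
  multiplies by the difference of potentials that \<open>invad\<close> divided by.\<close>

lemma commutator_S:
  "mulop V * S (Suc k) - S (Suc k) * mulop V = (\<Sum>a\<le>k. S a * B (k - a)) - lapl * S k"
proof (rule cop_eqI_mel)
  fix n m
  have V: "bounded (range V)"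
    using bounded_range[of "\<lambda>v. v"] .
  show "mel (mulop V * S (Suc k) - S (Suc k) * mulop V) n m
      = mel ((\<Sum>a\<le>k. S a * B (k - a)) - lapl * S k) n m"
  proof (cases "V n = V m")
    case True
    have "(\<Sum>a\<le>k. mel (S a * B (k - a)) n m) = mel (S 0 * B (k - 0)) n m"
      by (subst sum.remove[of _ 0])
        (auto intro!: sum.neutral mel_S_mult_B_eq_0[OF True])
    then show ?thesis
      using True by (simp add: mel_diff mel_sum mel_mulop_mult[OF V] mel_mult_mulop[OF V] B_def mel_diag)
  next
    case False
    define c where "c = complex_of_real (1 / (V n - V m))"
    have c: "(of_real (V n) - of_real (V m)) * c = 1"
      using False by (simp add: c_def)
    have "of_real (V n) * (c * x) - c * x * of_real (V m) = (of_real (V n) - of_real (V m)) * c * x" for x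
      by (simp add: algebra_simps)
    then show ?thesis
      unfolding mel_diff mel_mulop_mult[OF V] mel_mult_mulop[OF V] S_Suc mel_invad c_def[symmetric]
      by (simp add: c mel_diff)
  qed
qed

section \<open>Translation invariance along the periods\<close>

definition peri :: "(int ^ 'd) cop \<Rightarrow> bool" where
  "peri K \<longleftrightarrow> (\<forall>q n m. (\<forall>i. int (p $ i) dvd q $ i) \<longrightarrow> mel K (n + q) (m + q) = mel K n m)"

lemma periD: "peri K \<Longrightarrow> (\<And>i. int (p $ i) dvd q $ i) \<Longrightarrow> mel K (n + q) (m + q) = mel K n m"
  by (simp add: peri_def)

lemma V_add: "(\<And>i. int (p $ i) dvd q $ i) \<Longrightarrow> V (n + q) = V n"
  by (simp add: V_eq_iff)

lemma peri_mult:
  assumes "peri K" "peri L"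
  shows "peri (K * L)"
  unfolding peri_def
proof (intro allI impI)
  fix q n m
  assume q: "\<forall>i. int (p $ i) dvd q $ i"
  have "mel (K * L) (n + q) (m + q) = (\<Sum>\<^sub>\<infinity>l. mel K (n + q) (l + q) * mel L (l + q) (m + q))"
    unfolding mel_mult by (rule infsum_reindex_bij_betw[OF bij_add_right, symmetric])
  then show "mel (K * L) (n + q) (m + q) = mel (K * L) n m"
    using q by (simp add: mel_mult periD assms)
qed

lemma peri_lapl: "peri lapl"
  unfolding peri_def using mel_lapl_mult[of "1 :: (int ^ 'd) cop"]
  by (simp add: mel_one add.assoc add.commute[of _ e for e])

lemma peri_diff: "peri K \<Longrightarrow> peri L \<Longrightarrow> peri (K - L)"
  by (simp add: peri_def mel_diff)

lemma peri_sum: "(\<And>x. x \<in> I \<Longrightarrow> peri (f x)) \<Longrightarrow> peri (\<Sum>x\<in>I. f x)"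
  by (simp add: peri_def mel_sum)

lemma peri_diag: "peri K \<Longrightarrow> peri (diag K)"
  by (simp add: peri_def mel_diag V_add)

lemma peri_invad: "peri K \<Longrightarrow> peri (invad K)"
  by (simp add: peri_def mel_invad V_add)

lemma peri_S: "peri (S k)"
proof (induction k rule: less_induct)
  case (less k)
  show ?case
  proof (cases k)
    case 0
    then show ?thesis by (simp add: peri_def mel_one)
  next
    case (Suc j)
    then show ?thesis
      using less by (auto simp: S_Suc B_def intro!: peri_invad peri_diff peri_sum peri_mult peri_diag peri_lapl)
  qed
qed

lemma peri_B: "peri (B k)"
  by (simp add: B_def peri_diag peri_mult peri_lapl peri_S)

definition diag_peri :: "(int ^ 'd) cop \<Rightarrow> bool" where
  "diag_peri K \<longleftrightarrow> peri K \<and> (\<forall>n m. V n \<noteq> V m \<longrightarrow> mel K n m = 0)"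

lemma diag_peri_B: "diag_peri (B k)"
  by (simp add: diag_peri_def peri_B mel_B_eq_0)

lemma diag_peri_mulop: "diag_peri (mulop V)"
  using bounded_range[of "\<lambda>v. v"] by (auto simp: diag_peri_def peri_def mel_mulop V_add)

text \<open>Passing to the commutator multiplies the kernel by \<open>n $ i - m $ i\<close>, which
  depends on the difference of the sites only.\<close>

lemma diag_peri_posc: "diag_peri K \<Longrightarrow> posc i K L \<Longrightarrow> diag_peri L"
  by (simp add: diag_peri_def peri_def mel_posc)

(* On each class of sites modulo the periods such operators act as convolutions. *)
lemma diag_peri_commute:
  assumes K: "diag_peri K" and L: "diag_peri L"
  shows "K * L = L * K"
proof (rule cop_eqI_mel)
  fix n m :: "int ^ 'd"
  \<comment> \<open>This reflection of the intermediate site exchanges the two factors of a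
    convolution.\<close>
  have bij: "bij (\<lambda>l. n + m - l)"
    by (rule o_bij[of "\<lambda>l. n + m - l"]) (auto simp: fun_eq_iff algebra_simps)
  have K0: "mel K a b = 0" and L0: "mel L a b = 0" if "V a \<noteq> V b" for a b
    using that K L by (auto simp: diag_peri_def)
  have "mel K n (n + m - l) * mel L (n + m - l) m = mel L n l * mel K l m" for l
  proof -
    have V1: "V n = V (n + m - l) \<longleftrightarrow> V l = V m" and V2: "V (n + m - l) = V m \<longleftrightarrow> V n = V l"
      by (simp_all add: V_eq_iff)
    show ?thesis
    proof (cases "V l = V m \<and> V n = V l")
      case True
      have q1: "int (p $ i) dvd (l - n) $ i" and q2: "int (p $ i) dvd (l - m) $ i" for i
        using True V_eq_iff[of l n] V_eq_iff[of l m] by auto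
      \<comment> \<open>Translation by \<open>l - n\<close> takes the pair \<open>n\<close>,
        \<open>n + m - l\<close> to \<open>l\<close>, \<open>m\<close>; translation by
        \<open>l - m\<close> below takes \<open>n + m - l\<close>, \<open>m\<close> to
        \<open>n\<close>, \<open>l\<close>.\<close>
      have "mel K (n + (l - n)) (n + m - l + (l - n)) = mel K n (n + m - l)"
        using K q1 by (intro periD) (auto simp: diag_peri_def)
      moreover have "mel L (n + m - l + (l - m)) (m + (l - m)) = mel L (n + m - l) m"
        using L q2 by (intro periD) (auto simp: diag_peri_def)
      ultimately show ?thesis
        by (simp add: mult.commute)
    next
      case False
      then show ?thesis
        using V1 V2 K0 L0 by (metis mult_zero_left mult_zero_right)
    qed
  qed
  moreover have "mel (K * L) n m = (\<Sum>\<^sub>\<infinity>l. mel K n (n + m - l) * mel L (n + m - l) m)"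
    unfolding mel_mult by (rule infsum_reindex_bij_betw[OF bij, symmetric])
  ultimately show "mel (K * L) n m = mel (L * K) n m"
    by (simp add: mel_mult)
qed

section \<open>Finite range of the coefficients\<close>

lemma mel_mult_range:
  assumes "\<And>n m. a < l1_norm (n - m) \<Longrightarrow> mel K n m = 0"
    and "\<And>n m. b < l1_norm (n - m) \<Longrightarrow> mel L n m = 0"
    and "a + b < l1_norm (n - m)"
  shows "mel (K * L) n m = 0"
proof (rule mel_mult_eq_0I)
  fix l
  show "mel K n l * mel L l m = 0"
    using l1_norm_triangle[of n m l] assms(3) assms(1)[of n l] assms(2)[of l m] by fastforce
qed

lemma mel_lapl_range: "1 < l1_norm (n - m) \<Longrightarrow> mel lapl n m = 0"
  using mel_lapl_mult[of 1 n m]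
  by (auto simp: mel_one l1_norm_minus algebra_simps intro!: sum.neutral
      dest: arg_cong[where f = l1_norm])

text \<open>Ranges add under products, \<open>diag\<close> and \<open>invad\<close> do not enlarge
  them, and each step of the recursion brings in one more Laplacian.\<close>

lemma mel_S_range: "int k < l1_norm (n - m) \<Longrightarrow> mel (S k) n m = 0"
proof (induction k arbitrary: n m rule: less_induct)
  case (less k)
  show ?case
  proof (cases k)
    case 0
    then show ?thesis using less.prems by (auto simp: mel_one l1_norm_def)
  next
    case (Suc j)
    have lS: "mel (lapl * S i) a b = 0" if "i \<le> j" "int i + 1 < l1_norm (a - b)" for i a b
      using that Suc by (intro mel_mult_range[of 1 _ "int i"] less.IH mel_lapl_range) auto
    have "mel (S i * B (j - i)) n m = 0" if "i \<le> j" for i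
    proof (rule mel_mult_range)
      show "mel (S i) a b = 0" if "int i < l1_norm (a - b)" for a b
        using that \<open>i \<le> j\<close> Suc less.IH[of i] by auto
      show "mel (B (j - i)) a b = 0" if "int (j - i) + 1 < l1_norm (a - b)" for a b
        using that lS[of "j - i" a b] by (simp add: B_def mel_diag)
      show "int i + (int (j - i) + 1) < l1_norm (n - m)"
        using that less.prems Suc by auto
    qed
    then show ?thesis
      using lS[of j n m] less.prems by (simp add: Suc S_Suc mel_invad mel_diff mel_sum)
  qed
qed

lemma mel_B_range: "int k + 1 < l1_norm (n - m) \<Longrightarrow> mel (B k) n m = 0"
  unfolding B_def mel_diag
  by (subst mel_mult_range[of 1 lapl "int k" "S k"]) (auto intro: mel_lapl_range mel_S_range)

text \<open>Some component of \<open>n - m\<close> is a nonzero multiple of its period.\<close>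

lemma V_eq_imp_l1_norm_ge:
  assumes "V n = V m" "n \<noteq> m" "\<And>i. r \<le> p $ i"
  shows "int r \<le> l1_norm (n - m)"
proof -
  obtain i where "(n - m) $ i \<noteq> 0"
    using assms(2) by (auto simp: vec_eq_iff)
  moreover have "int (p $ i) dvd (n - m) $ i"
    using assms(1) V_eq_iff by blast
  ultimately have "int (p $ i) \<le> \<bar>(n - m) $ i\<bar>"
    using dvd_imp_le_int[of "(n - m) $ i" "int (p $ i)"] by simp
  with abs_component_le_l1_norm[of "n - m" i] assms(3)[of i] show ?thesis
    by linarith
qed

text \<open>The range of \<open>B k\<close> is too short to join two different sites of one class,
  so its kernel lives on the diagonal, where the factor \<open>n $ i - m $ i\<close>
  vanishes.\<close>

lemma posc_B_eq_0:
  assumes "posc i (B k) L" "Suc k < r" "\<And>i. r \<le> p $ i"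
  shows "L = 0"
proof (rule cop_eqI_mel)
  fix n m
  have "mel (B k) n m = 0" if "n \<noteq> m"
    using that mel_B_eq_0[of n m k] mel_B_range[of k n m] V_eq_imp_l1_norm_ge[of n m r] assms(2,3)
    by fastforce
  then show "mel L n m = mel 0 n m"
    by (auto simp: mel_posc[OF assms(1)] mel_zero)
qed

section \<open>The straight path and the leading coefficient\<close>

text \<open>Among the neighbours of \<open>n\<close> only \<open>n + axis i 1\<close> is within
  range \<open>k\<close> of the target.\<close>

lemma mel_lapl_mult_S_axis:
  "mel (lapl * S k) n (n + axis i (int (Suc k)))
    = mel (S k) (n + axis i 1) (n + axis i 1 + axis i (int k))"
proof -
  have eq: "n + axis i (int (Suc k)) = n + axis i 1 + axis i (int k)"
    by (auto simp: vec_eq_iff axis_def)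
  have "mel (S k) (n + e) (n + axis i (int (Suc k))) = 0" if "l1_norm e = 1" "e \<noteq> axis i 1" for e
  proof (rule mel_S_range, rule ccontr)
    assume "\<not> int k < l1_norm (n + e - (n + axis i (int (Suc k))))"
    then show False
      using unit_step_eq_axis[of e i k] that by (simp add: not_less)
  qed
  then have "mel (lapl * S k) n (n + axis i (int (Suc k)))
      = (\<Sum>e\<in>{axis i 1}. mel (S k) (n + e) (n + axis i (int (Suc k))))"
    unfolding mel_lapl_mult
    by (intro sum.mono_neutral_right) (auto simp: finite_l1_norm_eq l1_norm_axis)
  then show ?thesis
    unfolding eq by simp
qed

text \<open>The terms \<open>S a * B (k - a)\<close> drop out: \<open>S a\<close> does not reach the
  target, and \<open>B (k - a)\<close> does not join it to another site of its class. Only the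
  straight path remains, and each step multiplies by \<open>- 1 / (V n - V m)\<close> for sites
  \<open>n\<close>, \<open>m\<close> of different classes.\<close>

lemma mel_S_axis_nonzero:
  assumes r: "\<And>i. r \<le> p $ i"
  shows "k < r \<Longrightarrow> mel (S k) n (n + axis i (int k)) \<noteq> 0"
proof (induction k arbitrary: n)
  case 0
  have "axis i 0 = (0 :: int ^ 'd)"
    by (auto simp: vec_eq_iff axis_def)
  then show ?case by (simp add: mel_one)
next
  case (Suc k)
  let ?m = "n + axis i (int (Suc k))"
  have dist: "l1_norm (n - ?m) = int (Suc k)"
    by (simp add: l1_norm_axis l1_norm_minus)
  have "V n \<noteq> V ?m"
    using V_eq_imp_l1_norm_ge[of n ?m r] dist Suc.prems r by (fastforce simp: l1_norm_def)
  moreover have "mel (S a * B (k - a)) n ?m = 0" if "a \<le> k" for a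
  proof (rule mel_mult_eq_0I)
    fix l
    show "mel (S a) n l * mel (B (k - a)) l ?m = 0"
    proof (cases "l = ?m")
      case True
      then show ?thesis
        using that dist mel_S_range[of a n ?m] by simp
    next
      case False
      then have "mel (B (k - a)) l ?m = 0"
        using V_eq_imp_l1_norm_ge[of l ?m r] r mel_B_eq_0[of l ?m] mel_B_range[of "k - a" l ?m]
          Suc.prems that by fastforce
      then show ?thesis by simp
    qed
  qed
  ultimately show ?case
    using Suc.IH[of "n + axis i 1"] Suc.prems
    by (simp add: S_Suc mel_invad mel_diff mel_sum mel_lapl_mult_S_axis del: of_nat_Suc)
qed

text \<open>After a full period the end points share a class, so \<open>diag\<close> keeps the
  entry, which equals that of \<open>S\<close> over the remaining \<open>p $ i - 1\<close>
  steps.\<close>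

lemma mel_B_axis_nonzero:
  assumes "\<And>j. p $ i \<le> p $ j" "1 \<le> p $ i"
  shows "mel (B (p $ i - 1)) 0 (axis i (int (p $ i))) \<noteq> 0"
proof -
  have "V 0 = V (axis i (int (p $ i)))"
    by (simp add: V_eq_iff axis_def)
  then show ?thesis
    using mel_S_axis_nonzero[of "p $ i" "p $ i - 1" "axis i 1" i] assms
      mel_lapl_mult_S_axis[of "p $ i - 1" 0 i]
    by (simp add: B_def mel_diag)
qed

section \<open>Geometric bounds for the coefficients\<close>

text \<open>The projections commute with position, so the constant involves their norms
  only.\<close>

lemma bnd_diag: "\<exists>c\<ge>1. \<forall>i K b. bnd i K b \<longrightarrow> bnd i (diag K) (c * b)"
proof -
  define c where "c = (\<Sum>v\<in>range V. (norm (proj v))\<^sup>2)"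
  have P: "bnd i (proj v) (norm (proj v))" for i v
    unfolding proj_def by (intro bnd_mulop bounded_range)
  have "bnd i (diag K) (c * b)" if "bnd i K b" for i K b
  proof -
    have "bnd i (diag K) (\<Sum>v\<in>range V. norm (proj v) * b * norm (proj v))"
      unfolding diag_def by (intro bnd_sum bnd_mult P that)
    also have "(\<Sum>v\<in>range V. norm (proj v) * b * norm (proj v)) = c * b"
      unfolding c_def sum_distrib_right by (simp add: power2_eq_square ac_simps)
    finally show ?thesis .
  qed
  then have "bnd i (diag K) (max 1 c * b)" if "bnd i K b" for i K b
    by (rule bnd_mono) (use that bnd_nonneg[OF that] in \<open>auto intro: mult_right_mono\<close>)
  then show ?thesis
    by (intro exI[of _ "max 1 c"]) auto
qed

lemma bnd_invad: "\<exists>c\<ge>1. \<forall>i K b. bnd i K b \<longrightarrow> bnd i (invad K) (c * b)"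
proof -
  define c where "c = (\<Sum>v\<in>range V. \<Sum>w\<in>range V. \<bar>1 / (v - w)\<bar> * (norm (proj v) * norm (proj w)))"
  have P: "bnd i (proj v) (norm (proj v))" for i v
    unfolding proj_def by (intro bnd_mulop bounded_range)
  have "bnd i (invad K) (c * b)" if "bnd i K b" for i K b
  proof -
    have "bnd i (invad K) (\<Sum>v\<in>range V. \<Sum>w\<in>range V. \<bar>1 / (v - w)\<bar> * (norm (proj v) * b * norm (proj w)))"
      unfolding invad_def by (intro bnd_sum bnd_scaleR bnd_mult P that)
    also have "(\<Sum>v\<in>range V. \<Sum>w\<in>range V. \<bar>1 / (v - w)\<bar> * (norm (proj v) * b * norm (proj w))) = c * b"
      unfolding c_def sum_distrib_right by (intro sum.cong refl) (simp add: ac_simps)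
    finally show ?thesis .
  qed
  then have "bnd i (invad K) (max 1 c * b)" if "bnd i K b" for i K b
    by (rule bnd_mono) (use that bnd_nonneg[OF that] in \<open>auto intro: mult_right_mono\<close>)
  then show ?thesis
    by (intro exI[of _ "max 1 c"]) auto
qed

text \<open>Taking bounds in the recursion turns it into the one for \<open>catalan M\<close>, which
  grows at most geometrically.\<close>

lemma bnd_S_B_component: "\<exists>A\<ge>1. \<exists>c\<ge>1. \<forall>k. bnd i (S k) (c * A ^ k) \<and> bnd i (B k) (c * A ^ k)"
proof -
  obtain d where d: "1 \<le> d" "\<And>K b. bnd i K b \<Longrightarrow> bnd i (diag K) (d * b)"
    using bnd_diag by blast
  obtain c where c: "1 \<le> c" "\<And>K b. bnd i K b \<Longrightarrow> bnd i (invad K) (c * b)"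
    using bnd_invad by blast
  obtain l where l: "1 \<le> l" "bnd i lapl l"
    using bnd_lapl by blast
  \<comment> \<open>\<open>c * d * l\<close> bounds the factor at each term of the convolution, and
    \<open>c * l\<close> that of the single term \<open>lapl * S j\<close>.\<close>
  define M where "M = c * (d * l + l)"
  have M: "1 \<le> M"
    unfolding M_def using mult_mono[of 1 c 1 "d * l + l"] mult_mono[of 1 d 1 l] c d l by auto
  let ?m = "catalan M"
  have m: "0 \<le> ?m k" for k
    using M by (intro catalan_nonneg) auto
  have S: "bnd i (S k) (?m k)" for k
  proof (induction k rule: less_induct)
    case (less k)
    show ?case
    proof (cases k)
      case 0
      then show ?thesis by (simp add: bnd_one)
    next
      case (Suc j)
      have S: "bnd i (S a) (?m a)" if "a \<le> j" for a
        using that less Suc by simp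
      define s where "s = (\<Sum>a\<le>j. ?m a * ?m (j - a))"
      have "bnd i ((\<Sum>a\<le>j. S a * B (j - a)) + (-1) *\<^sub>R (lapl * S j))
          ((\<Sum>a\<le>j. ?m a * (d * (l * ?m (j - a)))) + \<bar>-1\<bar> * (l * ?m j))"
        unfolding B_def by (intro bnd_add bnd_sum bnd_mult bnd_scaleR d l S) auto
      then have "bnd i (S k) (c * ((\<Sum>a\<le>j. ?m a * (d * (l * ?m (j - a)))) + l * ?m j))"
        using c by (simp add: Suc S_Suc)
      also have "(\<Sum>a\<le>j. ?m a * (d * (l * ?m (j - a)))) = d * l * s"
        unfolding s_def sum_distrib_left by (simp add: ac_simps)
      finally show ?thesis
      proof (rule bnd_mono)
        \<comment> \<open>As \<open>catalan M 0 = 1\<close>, the summand \<open>a = 0\<close> lets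
          the convolution absorb the single term.\<close>
        have "?m 0 * ?m (j - 0) \<le> s"
          unfolding s_def by (rule member_le_sum) (auto intro!: mult_nonneg_nonneg m)
        then have "l * ?m j \<le> l * s"
          using l by simp
        then have "c * (d * l * s + l * ?m j) \<le> c * (d * l * s + l * s)"
          using c by simp
        also have "\<dots> = M * s"
          by (simp add: M_def algebra_simps)
        also have "\<dots> = ?m k"
          by (simp add: Suc s_def)
        finally show "c * (d * l * s + l * ?m j) \<le> ?m k" .
      qed
    qed
  qed
  have S2: "bnd i (S k) (2 * (4 * M) ^ k)" for k
    using bnd_mono[OF S catalan_le] M by simp
  have dl: "1 \<le> d * l"
    using d l mult_mono[of 1 d 1 l] by auto
  have B2: "bnd i (B k) (2 * (d * l) * (4 * M) ^ k)" for k
    using d(2)[OF bnd_mult[OF l(2) S2[of k]]] by (simp add: B_def ac_simps)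
  have S3: "bnd i (S k) (2 * (d * l) * (4 * M) ^ k)" for k
    using S2[of k] by (rule bnd_mono) (use dl M in \<open>auto intro!: mult_right_mono\<close>)
  show ?thesis
    using M dl B2 S3 by (intro exI[of _ "4 * M"] exI[of _ "2 * (d * l)"] conjI allI) auto
qed

lemma bnd_S_B: "\<exists>A\<ge>1. \<exists>c\<ge>1. \<forall>i k. bnd i (S k) (c * A ^ k) \<and> bnd i (B k) (c * A ^ k)"
proof -
  obtain A c where Ac: "\<And>i. 1 \<le> A i" "\<And>i. 1 \<le> c i"
    "\<And>i k. bnd i (S k) (c i * A i ^ k)" "\<And>i k. bnd i (B k) (c i * A i ^ k)"
    using bnd_S_B_component by metis
  have nonneg: "0 \<le> A i" "0 \<le> c i" for i
    using Ac(1,2)[of i] by auto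
  \<comment> \<open>Sums over the finitely many coordinates dominate every single constant and give
    bounds uniform in \<open>i\<close>.\<close>
  have A: "A i \<le> (\<Sum>i\<in>UNIV. A i)" and c: "c i \<le> (\<Sum>i\<in>UNIV. c i)" for i
    by (rule member_le_sum; simp add: nonneg)+
  have le: "c i * A i ^ k \<le> (\<Sum>i\<in>UNIV. c i) * (\<Sum>i\<in>UNIV. A i) ^ k" for i k
    using A c nonneg by (intro mult_mono power_mono) (auto intro: sum_nonneg)
  show ?thesis
    using bnd_mono[OF Ac(3) le] bnd_mono[OF Ac(4) le] Ac(1,2) A c
    by (meson order_trans)
qed

end

section \<open>Asymptotic velocity for large coupling\<close>

definition vnorm :: "('d::finite \<Rightarrow> 'a cop) \<Rightarrow> 'a ell2 \<Rightarrow> real" where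
  "vnorm Y \<psi> = norm (\<chi> i. app (Y i) \<psi>)"

lemma norm_vec_lambda_cong:
  assumes "\<And>i. norm (f i) = norm (g i)"
  shows "norm (\<chi> i. f i) = norm (\<chi> i. g i)"
  by (simp add: norm_vec_def assms)

lemma norm_vec_lambda_le_sum: "norm (\<chi> i. f i) \<le> (\<Sum>i\<in>UNIV. norm (f i))"
  unfolding norm_vec_def by (rule order_trans[OF L2_set_le_sum]) auto

lemma vnorm_le: "vnorm Y \<psi> \<le> (\<Sum>i\<in>UNIV. norm (Y i)) * norm \<psi>"
  unfolding vnorm_def sum_distrib_right
  by (rule order_trans[OF norm_vec_lambda_le_sum]) (intro sum_mono norm_app_le)

lemma vnorm_scaleR: "vnorm (\<lambda>i. r *\<^sub>R Y i) \<psi> = \<bar>r\<bar> * vnorm Y \<psi>"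
proof -
  have "(\<chi> i. app (r *\<^sub>R Y i) \<psi>) = r *\<^sub>R (\<chi> i. app (Y i) \<psi>)"
    by (simp add: vec_eq_iff app_scaleR)
  then show ?thesis
    by (simp add: vnorm_def)
qed

lemma vnorm_diff_le: "\<bar>vnorm Y \<psi> - vnorm Z \<psi>\<bar> \<le> (\<Sum>i\<in>UNIV. norm (Y i - Z i)) * norm \<psi>"
proof -
  have "(\<chi> i. app (Y i) \<psi>) - (\<chi> i. app (Z i) \<psi>) = (\<chi> i. app (Y i - Z i) \<psi>)"
    by (simp add: vec_eq_iff app_diff)
  then have "\<bar>vnorm Y \<psi> - vnorm Z \<psi>\<bar> \<le> vnorm (\<lambda>i. Y i - Z i) \<psi>"
    using norm_triangle_ineq3[of "\<chi> i. app (Y i) \<psi>" "\<chi> i. app (Z i) \<psi>"]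
    by (simp add: vnorm_def)
  then show ?thesis
    using vnorm_le order_trans by blast
qed

(* The commuting velocities Q i make the conjugated position grow exactly linearly, and all
   commutators with s and s' contribute bounded terms. *)
lemma v_asy_state_conjugate:
  fixes h s s' b :: "(int ^ 'd::finite) cop"
  assumes s: "s * s' = 1" "s' * s = 1" and hs: "h * s = s * b" and h: "adj h h"
    and ds: "\<And>i. posc i s (ds i)" "\<And>i. posc i s' (ds' i)"
    and Q: "\<And>i. posc i b (Q i)" "\<And>i. Q i * b = b * Q i"
    and \<psi>: "\<psi> \<in> position_domain"
  shows "v_asy_state (blinfun_of_cop h) \<psi> = ereal (vnorm (\<lambda>i. s * Q i * s') \<psi>)"
proof -
  obtain \<xi> where \<xi>: "\<And>i. pos_rel i \<psi> (\<xi> i)"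
    using \<psi> by (rule position_domain_obtain) blast
  define E where "E = (\<lambda>t. exp (t *\<^sub>R - (iop * h)))"
  define F where "F = (\<lambda>t. exp (t *\<^sub>R - (iop * b)))"
  have js: "iop * s = s * iop"
    by (rule iop_commute)
  have "iop * h * s = s * (iop * b)"
    by (metis hs js mult.assoc)
  \<comment> \<open>Self-adjointness of \<open>b\<close> is not assumed, so \<open>F t\<close> may
    fail to be isometric; it is traded for the isometric \<open>E t\<close> before norms are
    taken.\<close>
  then have ES: "E t * s = s * F t" for t
    unfolding E_def F_def by (intro exp_intertwine) simp
  have SF: "s * F t * s' = E t" for t
    by (metis ES s(1) mult.assoc mult.right_neutral)
  have FS: "F t * s' = s' * E t" for t
    by (metis SF s(2) mult.assoc mult.left_neutral)
  have skew: "adj (iop * h) (- (iop * h))"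
    using adj_mult[OF adj_iop h] by (simp add: iop_commute)
  have normE: "norm (app (E t) \<phi>) = norm \<phi>" for t \<phi>
    unfolding E_def
    by (rule norm_app_exp_skew) (use adj_scaleR[OF skew, where r = "- t"] in simp)
  define Y where "Y = (\<lambda>i. s * Q i * s')"
  \<comment> \<open>The part of the evolved position that stays bounded in \<open>t\<close>: the
    initial position and the commutators with \<open>s\<close> and \<open>s'\<close>. Isometry of
    \<open>E t\<close> gives the bound \<open>M\<close> below.\<close>
  define w where "w = (\<lambda>t i. app (E t) (\<xi> i) + app (ds i * s') (app (E t) \<psi>) + app (E t) (app (s * ds' i) \<psi>))"
  define M where "M = (\<Sum>i\<in>UNIV. norm (\<xi> i) + norm (ds i * s') * norm \<psi> + norm (app (s * ds' i) \<psi>))"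
  have pos: "pos_rel i (app (E t) \<psi>) (w t i + t *\<^sub>R - (app (E t) (app iop (app (Y i) \<psi>))))" for t i
  proof -
    have "posc i (t *\<^sub>R - (iop * b)) (t *\<^sub>R - (iop * Q i))"
      using posc_scaleR[OF posc_mult[OF posc_iop Q(1)], where r = "- t"] by simp
    moreover have "t *\<^sub>R - (iop * Q i) * (t *\<^sub>R - (iop * b)) = t *\<^sub>R - (iop * b) * (t *\<^sub>R - (iop * Q i))"
    proof -
      have "iop * Q i * (iop * b) = iop * iop * (Q i * b)" "iop * b * (iop * Q i) = iop * iop * (b * Q i)"
        by (metis iop_commute mult.assoc)+
      then show ?thesis
        by (simp add: Q(2))
    qed
    ultimately have "posc i (F t) (F t * (t *\<^sub>R - (iop * Q i)))"
      unfolding F_def by (rule posc_exp)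
    from posc_mult[OF posc_mult[OF ds(1) this] ds(2)]
    have "posc i (E t) ((ds i * F t + s * (F t * (t *\<^sub>R - (iop * Q i)))) * s' + s * F t * ds' i)"
      by (simp add: SF)
    \<comment> \<open>Of the Leibniz terms for \<open>s * F t * s'\<close> only the middle one
      carries a factor \<open>t\<close>.\<close>
    moreover have "(ds i * F t + s * (F t * (t *\<^sub>R - (iop * Q i)))) * s' + s * F t * ds' i
        = ds i * s' * E t + t *\<^sub>R - (E t * iop * Y i) + E t * (s * ds' i)"
    proof -
      have 1: "ds i * F t * s' = ds i * s' * E t"
        by (simp add: mult.assoc FS)
      have "s * (F t * (iop * Q i)) * s' = E t * (s * iop) * Q i * s'"
        by (metis ES mult.assoc)
      then have 2: "s * (F t * (iop * Q i)) * s' = E t * iop * Y i"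
        by (simp add: Y_def mult.assoc flip: js)
      have 3: "s * F t * ds' i = E t * (s * ds' i)"
        by (metis ES mult.assoc)
      show ?thesis
        using 1 2 3 by (simp add: distrib_right left_diff_distrib)
    qed
    ultimately have "posc i (E t) (ds i * s' * E t + t *\<^sub>R - (E t * iop * Y i) + E t * (s * ds' i))"
      by simp
    from poscD[OF this \<xi>[of i]] show ?thesis
      by (simp add: w_def app_add app_diff app_mult app_scaleR app_uminus algebra_simps)
  qed
  have w_le: "norm (\<chi> i. w t i) \<le> M" for t
  proof -
    have "norm (w t i) \<le> norm (\<xi> i) + norm (ds i * s') * norm \<psi> + norm (app (s * ds' i) \<psi>)" for i
      unfolding w_def
      by (intro norm_triangle_le add_mono) (auto simp: normE intro: order_trans[OF norm_app_le])
    then show ?thesis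
      unfolding M_def by (intro order_trans[OF norm_vec_lambda_le_sum] sum_mono)
  qed
  define u where "u = (\<lambda>t. 1 / t * norm (position (evolution (blinfun_of_cop h) t \<psi>)))"
  have u_le: "\<bar>u t - vnorm Y \<psi>\<bar> \<le> M / t" if t: "0 < t" for t
  proof -
    let ?m = "\<chi> i. t *\<^sub>R - (app (E t) (app iop (app (Y i) \<psi>)))"
    have "position (evolution (blinfun_of_cop h) t \<psi>)
        = (\<chi> i. w t i + t *\<^sub>R - (app (E t) (app iop (app (Y i) \<psi>))))"
      unfolding evolution_eq_exp by (rule position_eqI) (use pos in \<open>simp add: E_def\<close>)
    also have "\<dots> = (\<chi> i. w t i) + ?m"
      by (simp add: vec_eq_iff)
    finally have "\<bar>norm (position (evolution (blinfun_of_cop h) t \<psi>)) - norm ?m\<bar> \<le> norm (\<chi> i. w t i)"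
      using norm_triangle_ineq3[of "(\<chi> i. w t i) + ?m" ?m] by simp
    \<comment> \<open>\<open>E t\<close> and \<open>iop\<close> are isometric, so the linear term
      has norm exactly \<open>t * vnorm Y \<psi>\<close>.\<close>
    moreover have "norm ?m = norm (\<chi> i. app (t *\<^sub>R Y i) \<psi>)"
      by (rule norm_vec_lambda_cong) (simp add: normE norm_app_iop app_scaleR)
    then have "norm ?m = t * vnorm Y \<psi>"
      using vnorm_scaleR[of t Y \<psi>] t by (simp add: vnorm_def)
    ultimately have "\<bar>norm (position (evolution (blinfun_of_cop h) t \<psi>)) - t * vnorm Y \<psi>\<bar> \<le> M"
      using w_le[of t] by simp
    then have "\<bar>norm (position (evolution (blinfun_of_cop h) t \<psi>)) - t * vnorm Y \<psi>\<bar> / t \<le> M / t"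
      using t by (simp add: divide_right_mono)
    moreover have "\<bar>norm (position (evolution (blinfun_of_cop h) t \<psi>)) - t * vnorm Y \<psi>\<bar> / t
        = \<bar>u t - vnorm Y \<psi>\<bar>"
      using t by (simp add: u_def abs_if field_simps)
    ultimately show ?thesis by simp
  qed
  have "((\<lambda>t. M / t) \<longlongrightarrow> 0) at_top"
    by (intro tendsto_divide_0[OF tendsto_const] filterlim_at_top_imp_at_infinity filterlim_ident)
  then have "((\<lambda>t. u t - vnorm Y \<psi>) \<longlongrightarrow> 0) at_top"
    by (rule Lim_null_comparison[rotated])
      (use u_le in \<open>auto intro!: eventually_at_top_linorderI[of 1]\<close>)
  then have "((\<lambda>t. ereal (u t)) \<longlongrightarrow> ereal (vnorm Y \<psi>)) at_top"
    by (simp add: LIM_zero_iff)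
  then have "Limsup at_top (\<lambda>t. ereal (u t)) = ereal (vnorm Y \<psi>)"
    by (intro lim_imp_Limsup) (auto simp: trivial_limit_at_top_linorder)
  then show ?thesis
    by (simp add: v_asy_state_def u_def Y_def)
qed

section \<open>Tails of power series\<close>

text \<open>At ratio at most 1/2 the full geometric sum is at most 2; the offset \<open>r\<close>
  makes the order of the remainder visible.\<close>

lemma geometric_tail:
  fixes x :: real
  assumes "0 \<le> x" "x \<le> 1 / 2" "0 \<le> c"
  shows "summable (\<lambda>k. c * x ^ (k + r))" "(\<Sum>k. c * x ^ (k + r)) \<le> 2 * c * x ^ r"
proof -
  have s: "(\<lambda>k. x ^ k) sums (1 / (1 - x))"
    using assms by (intro geometric_sums) auto
  have sums: "(\<lambda>k. c * x ^ (k + r)) sums (c * x ^ r * (1 / (1 - x)))"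
    using sums_mult[OF s, of "c * x ^ r"] by (simp add: power_add ac_simps)
  then show "summable (\<lambda>k. c * x ^ (k + r))"
    by (rule sums_summable)
  have "c * x ^ r * (1 / (1 - x)) \<le> c * x ^ r * 2"
    using assms by (intro mult_left_mono) (auto simp: field_simps)
  then show "(\<Sum>k. c * x ^ (k + r)) \<le> 2 * c * x ^ r"
    using sums by (simp add: sums_iff)
qed

lemma norm_power_series_tail:
  fixes f :: "nat \<Rightarrow> 'a::banach"
  assumes "\<And>k. norm (f k) \<le> c * A ^ k" "0 \<le> \<epsilon>" "0 \<le> A" "\<epsilon> * A \<le> 1 / 2" "0 \<le> c"
  shows "summable (\<lambda>k. norm (\<epsilon> ^ (k + r) *\<^sub>R f (k + r)))"
    and "norm (\<Sum>k. \<epsilon> ^ (k + r) *\<^sub>R f (k + r)) \<le> 2 * c * (\<epsilon> * A) ^ r"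
proof -
  have le: "norm (\<epsilon> ^ k *\<^sub>R f k) \<le> c * (\<epsilon> * A) ^ k" for k
    using mult_left_mono[OF assms(1)[of k], of "\<epsilon> ^ k"] assms(2)
    by (simp add: power_mult_distrib ac_simps)
  have x: "0 \<le> \<epsilon> * A"
    using assms by simp
  note g = geometric_tail[OF x assms(4,5), of r]
  show s: "summable (\<lambda>k. norm (\<epsilon> ^ (k + r) *\<^sub>R f (k + r)))"
    by (rule summable_comparison_test'[OF g(1), of 0]) (simp only: real_norm_def abs_norm_cancel le)
  have "norm (\<Sum>k. \<epsilon> ^ (k + r) *\<^sub>R f (k + r)) \<le> (\<Sum>k. norm (\<epsilon> ^ (k + r) *\<^sub>R f (k + r)))"
    by (rule summable_norm[OF s])
  also have "\<dots> \<le> (\<Sum>k. c * (\<epsilon> * A) ^ (k + r))"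
    by (rule suminf_le[OF le s g(1)])
  also have "\<dots> \<le> 2 * c * (\<epsilon> * A) ^ r"
    by (rule g(2))
  finally show "norm (\<Sum>k. \<epsilon> ^ (k + r) *\<^sub>R f (k + r)) \<le> 2 * c * (\<epsilon> * A) ^ r" .
qed

lemma bnd_power_series_tail:
  assumes "\<And>k. bnd i (f k) (c * A ^ k)" "0 \<le> \<epsilon>" "0 \<le> A" "\<epsilon> * A \<le> 1 / 2" "0 \<le> c"
  shows "bnd i (\<Sum>k. \<epsilon> ^ (k + r) *\<^sub>R f (k + r)) (2 * c * (\<epsilon> * A) ^ r)"
proof -
  have le: "bnd i (\<epsilon> ^ k *\<^sub>R f k) (c * (\<epsilon> * A) ^ k)" for k
    using bnd_scaleR[OF assms(1)[of k], of "\<epsilon> ^ k"] assms(2)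
    by (simp add: power_mult_distrib ac_simps)
  have x: "0 \<le> \<epsilon> * A"
    using assms by simp
  note g = geometric_tail[OF x assms(4,5), of r]
  show ?thesis
    by (rule bnd_mono[OF bnd_suminf[OF le g(1)] g(2)])
qed

section \<open>The conjugated velocity as a power series in the inverse coupling\<close>

context periodic_potential
begin

text \<open>\<open>commutator_S\<close> is weighted by \<open>\<epsilon> ^ Suc k\<close> and summed,
  with \<open>s * b\<close> as a Cauchy product; the term of order 0 vanishes as
  \<open>S 0 = 1\<close>.\<close>

lemma intertwining_series:
  assumes S: "summable (\<lambda>k. norm (\<epsilon> ^ k *\<^sub>R S k))" and B: "summable (\<lambda>k. norm (\<epsilon> ^ k *\<^sub>R B k))"
  defines "s \<equiv> \<Sum>k. \<epsilon> ^ k *\<^sub>R S k" and "b \<equiv> \<Sum>k. \<epsilon> ^ k *\<^sub>R B k"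
  shows "mulop V * s - s * mulop V = \<epsilon> *\<^sub>R (s * b - lapl * s)"
proof -
  have s: "(\<lambda>k. \<epsilon> ^ k *\<^sub>R S k) sums s"
    unfolding s_def by (rule summable_sums[OF summable_norm_cancel[OF S]])
  define f where "f = (\<lambda>k. mulop V * (\<epsilon> ^ k *\<^sub>R S k) - \<epsilon> ^ k *\<^sub>R S k * mulop V)"
  have f: "f sums (mulop V * s - s * mulop V)"
    unfolding f_def by (intro sums_diff sums_mult sums_mult2 s)
  have f0: "f 0 = 0"
    by (simp add: f_def)
  have fSuc: "f (Suc k) = \<epsilon> *\<^sub>R ((\<Sum>a\<le>k. \<epsilon> ^ a *\<^sub>R S a * (\<epsilon> ^ (k - a) *\<^sub>R B (k - a))) - lapl * (\<epsilon> ^ k *\<^sub>R S k))" for k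
  proof -
    have "\<epsilon> ^ a *\<^sub>R S a * (\<epsilon> ^ (k - a) *\<^sub>R B (k - a)) = \<epsilon> ^ k *\<^sub>R (S a * B (k - a))" if "a \<le> k" for a
      using that by (simp flip: power_add)
    then have "(\<Sum>a\<le>k. \<epsilon> ^ a *\<^sub>R S a * (\<epsilon> ^ (k - a) *\<^sub>R B (k - a))) = \<epsilon> ^ k *\<^sub>R (\<Sum>a\<le>k. S a * B (k - a))"
      unfolding scaleR_sum_right by (intro sum.cong) auto
    moreover have "f (Suc k) = \<epsilon> ^ Suc k *\<^sub>R (mulop V * S (Suc k) - S (Suc k) * mulop V)"
      by (simp add: f_def scaleR_diff_right)
    ultimately show ?thesis
      unfolding commutator_S by (simp add: scaleR_diff_right)
  qed
  have "(\<lambda>k. f (Suc k)) sums (\<epsilon> *\<^sub>R (s * b - lapl * s))"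
    unfolding fSuc
    by (intro sums_scaleR_right sums_diff sums_mult s) (unfold s_def b_def, rule Cauchy_product_sums[OF S B])
  then show ?thesis
    using f sums_Suc_iff[of f] f0 sums_unique2 by fastforce
qed

lemma suminf_mult_commute:
  fixes f :: "nat \<Rightarrow> 'a::real_normed_algebra"
  assumes "summable f" "\<And>k. f k * y = y * f k"
  shows "suminf f * y = y * suminf f"
  using suminf_mult2[OF assms(1), of y] suminf_mult[OF assms(1), of y] assms(2) by simp

text \<open>One \<open>Y\<close> serves all states, which makes the estimate uniform enough for the
  supremum. The series \<open>Q\<close> of commutators of the \<open>B k\<close> starts with
  \<open>T\<close> at order \<open>p0 - 1\<close>, and conjugating it by \<open>s\<close> costs one
  order more.\<close>

lemma velocity_estimate:
  assumes p0: "1 \<le> p0" "\<And>i. p0 \<le> p $ i" and T: "\<And>i. posc i (B (p0 - 1)) (T i)"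
  shows "\<exists>\<epsilon>0>0. \<exists>K. \<forall>\<epsilon>. 0 < \<epsilon> \<and> \<epsilon> \<le> \<epsilon>0 \<longrightarrow> (\<exists>Y.
    (\<forall>\<psi>\<in>position_domain. v_asy_state (schroedinger (1 / \<epsilon>) V) \<psi> = ereal (vnorm Y \<psi>)) \<and>
    (\<Sum>i\<in>UNIV. norm (Y i - \<epsilon> ^ (p0 - 1) *\<^sub>R T i)) \<le> K * \<epsilon> ^ p0)"
proof -
  obtain A c where A: "1 \<le> A" and c: "1 \<le> c"
    and bS: "\<And>i k. bnd i (S k) (c * A ^ k)" and bB: "\<And>i k. bnd i (B k) (c * A ^ k)"
    using bnd_S_B by blast
  have V: "bounded (range V)"
    using bounded_range[of "\<lambda>v. v"] .
  obtain L where L: "\<And>i k. posc i (B k) (L i k)" and nL: "\<And>i k. norm (B k) + norm (L i k) \<le> c * A ^ k"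
    using bB unfolding bnd_def by metis
  have nL: "norm (L i k) \<le> c * A ^ k" for i k
    using nL[of k i] norm_ge_zero[of "B k"] by linarith
  have nS: "norm (S k) \<le> c * A ^ k" and nB: "norm (B k) \<le> c * A ^ k" for k
    using bnd_norm[OF bS] bnd_norm[OF bB] by auto
  have LT: "L i (p0 - 1) = T i" for i
    using posc_unique[OF L T] .
  have L0: "L i k = 0" if "k < p0 - 1" for i k
    by (rule posc_B_eq_0[OF L, of k p0]) (use that p0 in auto)
  \<comment> \<open>\<open>2 * c\<close> bounds the tail of \<open>Q i\<close> after its leading
    term, \<open>16 * c\<^sup>2\<close> the effect of conjugation; the cardinality counts the
    coordinates.\<close>
  define K where "K = of_nat CARD('d) * ((2 * c + 16 * c\<^sup>2) * A ^ p0)"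
  have "\<exists>Y. (\<forall>\<psi>\<in>position_domain. v_asy_state (schroedinger (1 / \<epsilon>) V) \<psi> = ereal (vnorm Y \<psi>)) \<and>
      (\<Sum>i\<in>UNIV. norm (Y i - \<epsilon> ^ (p0 - 1) *\<^sub>R T i)) \<le> K * \<epsilon> ^ p0"
    if \<epsilon>: "0 < \<epsilon>" "\<epsilon> \<le> 1 / (4 * c * A)" for \<epsilon>
  proof -
    define x where "x = \<epsilon> * A"
    \<comment> \<open>The threshold for \<open>\<epsilon>\<close> is chosen for this bound, which
      keeps the norm of \<open>s - 1\<close> at most 1/2 and makes \<open>s\<close>
      invertible.\<close>
    have cx: "2 * c * x \<le> 1 / 2"
      using \<epsilon>(2) c A by (simp add: x_def field_simps)
    have x: "0 \<le> x" "x \<le> 1 / 2"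
    proof -
      show "0 \<le> x"
        using \<epsilon> A by (simp add: x_def)
      then have "1 * x \<le> c * x"
        using c by (intro mult_right_mono) auto
      then show "x \<le> 1 / 2"
        using cx \<open>0 \<le> x\<close> by linarith
    qed
    have \<epsilon>A: "0 \<le> \<epsilon>" "0 \<le> A" "\<epsilon> * A \<le> 1 / 2" "0 \<le> c"
      using \<epsilon> A c x by (auto simp: x_def)
    define s where "s = (\<Sum>k. \<epsilon> ^ k *\<^sub>R S k)"
    define b where "b = (\<Sum>k. \<epsilon> ^ k *\<^sub>R B k)"
    define Q where "Q = (\<lambda>i. \<Sum>k. \<epsilon> ^ k *\<^sub>R L i k)"
    note sumS = norm_power_series_tail(1)[OF nS \<epsilon>A, where r = 0, unfolded add_0_right]
    note sumB = norm_power_series_tail(1)[OF nB \<epsilon>A, where r = 0, unfolded add_0_right]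
    note sumL = norm_power_series_tail(1)[OF nL \<epsilon>A, where r = 0, unfolded add_0_right]
    note sS = summable_norm_cancel[OF sumS] and sB = summable_norm_cancel[OF sumB]
      and sL = summable_norm_cancel[OF sumL]
    define G where "G = (\<Sum>k. \<epsilon> ^ (k + 1) *\<^sub>R S (k + 1))"
    have sG: "s = 1 + G"
      unfolding s_def G_def using suminf_split_initial_segment[OF sS, of 1] by simp
    have bG: "bnd i G (1 / 2)" for i
      using bnd_mono[OF bnd_power_series_tail[OF bS \<epsilon>A, of i 1]] cx unfolding G_def x_def by simp
    have nG: "norm G \<le> 2 * c * x"
      using norm_power_series_tail(2)[OF nS \<epsilon>A, where r = 1] unfolding G_def x_def by simp
    define s' where "s' = (\<Sum>n. (- G) ^ n)"
    have bG': "bnd i (- G) (1 / 2)" for i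
      using bnd_scaleR[OF bG, of i "- 1"] by simp
    have "norm (- G) < 1"
      using nG cx by simp
    from neumann[OF this] have ss': "s * s' = 1" "s' * s = 1"
      by (simp_all add: sG s'_def)
    have half: "summable (\<lambda>n. (1 / 2 :: real) ^ n)"
      by (simp add: summable_geometric)
    \<comment> \<open>Summing the Neumann series with \<open>bnd\<close> instead of the norm also
      provides the commutator of \<open>s'\<close> with position.\<close>
    have bs': "bnd i s' 2" for i
      using bnd_suminf[OF bnd_power[OF bG'] half] suminf_geometric[of "1 / 2 :: real"]
      by (simp add: s'_def)
    have ns': "norm s' \<le> 2"
      by (rule bnd_norm[OF bs'])
    have bs: "bnd i s (1 + 1 / 2)" for i
      unfolding sG by (intro bnd_add bnd_one bG)
    define h where "h = lapl + mulop (\<lambda>n. (1 / \<epsilon>) * V n)"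
    define b' where "b' = (1 / \<epsilon>) *\<^sub>R mulop V + b"
    have V': "bounded (range (\<lambda>n. (1 / \<epsilon>) * V n))"
      by (rule bounded_range)
    have hV: "h = lapl + (1 / \<epsilon>) *\<^sub>R mulop V"
      unfolding h_def
      by (rule arg_cong[where f = "(+) lapl"], rule cop_eqI_mel)
        (unfold mel_mulop[OF V'] mel_mulop[OF V] mel_scaleR, simp)
    have "(1 / \<epsilon>) *\<^sub>R (mulop V * s - s * mulop V) = s * b - lapl * s"
      using intertwining_series[OF sumS sumB] \<epsilon> unfolding s_def[symmetric] b_def[symmetric] by simp
    then have hs: "h * s = s * b'"
      by (simp add: hV b'_def algebra_simps)
    have h: "adj h h"
      unfolding h_def by (intro adj_add adj_lapl adj_mulop V')
    have hS: "blinfun_of_cop h = schroedinger (1 / \<epsilon>) V"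
      unfolding h_def schroedinger_def plus_cop.rep_eq blinfun_of_lapl blinfun_of_mulop[OF V'] ..
    obtain ds ds' where ds: "\<And>i. posc i s (ds i)" "\<And>i. posc i s' (ds' i)"
      using bs bs' unfolding bnd_def by metis
    have Qb: "posc i b (Q i)" for i
      unfolding b_def Q_def
      by (rule posc_sums[OF summable_sums summable_sums posc_scaleR[OF L]])
        (rule sB sL)+
    have Qb': "posc i b' (Q i)" for i
      unfolding b'_def using posc_add[OF posc_scaleR[OF posc_mulop[OF V]] Qb] by simp
    have dpL: "diag_peri (L i k)" for i k
      using diag_peri_B L by (rule diag_peri_posc)
    have QV: "Q i * mulop V = mulop V * Q i" for i
      unfolding Q_def
      by (rule suminf_mult_commute[OF sL]) (simp add: diag_peri_commute[OF dpL diag_peri_mulop])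
    have LB: "L i k * b = b * L i k" for i k
      unfolding b_def
      by (rule suminf_mult_commute[OF sB, symmetric]) (simp add: diag_peri_commute[OF dpL diag_peri_B])
    have "Q i * b = b * Q i" for i
      unfolding Q_def
      by (rule suminf_mult_commute[OF sL]) (simp add: LB)
    then have Qc: "Q i * b' = b' * Q i" for i
      by (simp add: b'_def QV algebra_simps)
    define Y where "Y = (\<lambda>i. s * Q i * s')"
    have "\<forall>\<psi>\<in>position_domain. v_asy_state (schroedinger (1 / \<epsilon>) V) \<psi> = ereal (vnorm Y \<psi>)"
      using v_asy_state_conjugate[OF ss' hs h ds Qb' Qc] unfolding hS Y_def by blast
    moreover have "norm (Y i - \<epsilon> ^ (p0 - 1) *\<^sub>R T i) \<le> (2 * c + 16 * c\<^sup>2) * A ^ p0 * \<epsilon> ^ p0" for i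
    proof -
      have Q1: "Q i = (\<Sum>k. \<epsilon> ^ (k + (p0 - 1)) *\<^sub>R L i (k + (p0 - 1)))"
        unfolding Q_def
        using suminf_split_initial_segment[OF sL, where k = "p0 - 1"] by (simp add: L0)
      have Q2: "Q i - \<epsilon> ^ (p0 - 1) *\<^sub>R T i = (\<Sum>k. \<epsilon> ^ (k + p0) *\<^sub>R L i (k + p0))"
      proof -
        \<comment> \<open>The commutators of index below \<open>p0 - 1\<close> vanish, so the first
          \<open>p0\<close> terms reduce to the leading one.\<close>
        have "(\<Sum>k<p0. \<epsilon> ^ k *\<^sub>R L i k) = (\<Sum>k\<in>{p0 - 1}. \<epsilon> ^ k *\<^sub>R L i k)"
          using p0(1) L0 by (intro sum.mono_neutral_right) auto
        then have "(\<Sum>k<p0. \<epsilon> ^ k *\<^sub>R L i k) = \<epsilon> ^ (p0 - 1) *\<^sub>R T i"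
          using LT[of i] by simp
        then show ?thesis
          unfolding Q_def using suminf_split_initial_segment[OF sL, where k = p0] by simp
      qed
      have nQ: "norm (Q i) \<le> 2 * c * x ^ (p0 - 1)"
        unfolding Q1 x_def by (rule norm_power_series_tail(2)[OF nL \<epsilon>A])
      have nQT: "norm (Q i - \<epsilon> ^ (p0 - 1) *\<^sub>R T i) \<le> 2 * c * x ^ p0"
        unfolding Q2 x_def by (rule norm_power_series_tail(2)[OF nL \<epsilon>A])
      \<comment> \<open>Conjugation changes \<open>Q i\<close> through its commutator with
        \<open>s = 1 + G\<close>, to which the 1 does not contribute; \<open>norm G\<close> supplies
        the extra factor \<open>x\<close>.\<close>
      have "Y i - Q i = (s * Q i - Q i * s) * s'"
        by (simp add: Y_def left_diff_distrib mult.assoc ss')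
      also have "\<dots> = (G * Q i - Q i * G) * s'"
        by (simp add: sG algebra_simps)
      finally have "norm (Y i - Q i) \<le> norm (G * Q i - Q i * G) * norm s'"
        using norm_mult_ineq by simp
      also have "\<dots> \<le> (norm G * norm (Q i) + norm (Q i) * norm G) * 2"
        by (intro mult_mono norm_triangle_le_diff add_mono norm_mult_ineq ns') auto
      also have "\<dots> = 4 * (norm G * norm (Q i))"
        by simp
      also have "\<dots> \<le> 4 * ((2 * c * x) * (2 * c * x ^ (p0 - 1)))"
        using nG nQ x c by (intro mult_left_mono mult_mono) auto
      also have "\<dots> = 16 * c\<^sup>2 * x ^ p0"
        using p0(1) by (cases p0) (auto simp: power2_eq_square)
      finally have "norm (Y i - Q i) \<le> 16 * c\<^sup>2 * x ^ p0" .
      moreover have "norm (Y i - \<epsilon> ^ (p0 - 1) *\<^sub>R T i) \<le> norm (Y i - Q i) + norm (Q i - \<epsilon> ^ (p0 - 1) *\<^sub>R T i)"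
        using norm_triangle_ineq[of "Y i - Q i" "Q i - \<epsilon> ^ (p0 - 1) *\<^sub>R T i"] by simp
      ultimately have "norm (Y i - \<epsilon> ^ (p0 - 1) *\<^sub>R T i) \<le> (2 * c + 16 * c\<^sup>2) * x ^ p0"
        using nQT by (simp add: distrib_right)
      then show ?thesis
        by (simp add: x_def power_mult_distrib ac_simps)
    qed
    then have "(\<Sum>i\<in>UNIV. norm (Y i - \<epsilon> ^ (p0 - 1) *\<^sub>R T i))
        \<le> (\<Sum>i\<in>(UNIV :: 'd set). (2 * c + 16 * c\<^sup>2) * A ^ p0 * \<epsilon> ^ p0)"
      by (rule sum_mono)
    then have "(\<Sum>i\<in>UNIV. norm (Y i - \<epsilon> ^ (p0 - 1) *\<^sub>R T i)) \<le> K * \<epsilon> ^ p0"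
      by (simp add: K_def)
    ultimately show ?thesis by blast
  qed
  moreover have "0 < 1 / (4 * c * A)"
    using A c by simp
  ultimately show ?thesis by blast
qed

end

section \<open>Suprema, the potential and the final asymptotics\<close>

lemma abs_SUP_diff_le:
  fixes f g :: "'a \<Rightarrow> real"
  assumes "I \<noteq> {}" "bdd_above (g ` I)" "0 < a" "\<And>x. x \<in> I \<Longrightarrow> \<bar>f x - a * g x\<bar> \<le> b"
  shows "bdd_above (f ` I)" "\<bar>(SUP x\<in>I. f x) - a * (SUP x\<in>I. g x)\<bar> \<le> b"
proof -
  have f: "f x \<le> a * (SUP x\<in>I. g x) + b" if "x \<in> I" for x
  proof -
    have "a * g x \<le> a * (SUP x\<in>I. g x)"
      using cSUP_upper[OF that assms(2)] assms(3) by simp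
    with assms(4)[OF that] show ?thesis
      by linarith
  qed
  then show bdd: "bdd_above (f ` I)"
    by (auto intro!: bdd_aboveI2)
  have "g x \<le> ((SUP x\<in>I. f x) + b) / a" if "x \<in> I" for x
    using assms(4)[OF that] cSUP_upper[OF that bdd] assms(3) by (simp add: field_simps)
  then have "(SUP x\<in>I. g x) \<le> ((SUP x\<in>I. f x) + b) / a"
    by (rule cSUP_least[OF assms(1)])
  then have "a * (SUP x\<in>I. g x) \<le> (SUP x\<in>I. f x) + b"
    using assms(3) by (simp add: field_simps)
  moreover have "(SUP x\<in>I. f x) \<le> a * (SUP x\<in>I. g x) + b"
    using f by (rule cSUP_least[OF assms(1)])
  ultimately show "\<bar>(SUP x\<in>I. f x) - a * (SUP x\<in>I. g x)\<bar> \<le> b"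
    by linarith
qed

text \<open>Reduction modulo the periods moves every site into the fundamental cell without changing
  \<open>V\<close>, and there \<open>V\<close> is injective.\<close>

lemma periodic_potentialI:
  fixes p :: "nat ^ 'd::finite"
  assumes p: "\<And>i. 1 \<le> p $ i" and "periodic p V" "non_degenerate p V"
  shows "periodic_potential p V"
proof
  define w :: "int ^ 'd \<Rightarrow> int ^ 'd" where "w = (\<lambda>n. \<chi> i. n $ i mod int (p $ i))"
  have w: "w n \<in> fundamental_cell p" for n
    using p by (auto simp: w_def fundamental_cell_def Suc_le_eq)
  have V_add: "V (n + m) = V n" if "\<And>i. int (p $ i) dvd m $ i" for n m
    using assms(2) that unfolding periodic_def by blast
  have Vw: "V n = V (w n)" for n
    using V_add[of "n - w n" "w n"] by (simp add: w_def minus_mod_eq_mult_div)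
  show "V n = V m \<longleftrightarrow> (\<forall>i. int (p $ i) dvd (n - m) $ i)" for n m
  proof
    assume "V n = V m"
    then have "w n = w m"
      using assms(3) w Vw[of n] Vw[of m] unfolding non_degenerate_def inj_on_def by metis
    then show "\<forall>i. int (p $ i) dvd (n - m) $ i"
      by (simp add: w_def vec_eq_iff mod_eq_dvd_iff)
  next
    assume "\<forall>i. int (p $ i) dvd (n - m) $ i"
    then show "V n = V m"
      using V_add[of "n - m" m] by simp
  qed
  have "range V \<subseteq> (\<lambda>f. V (vec_lambda f)) ` (\<Pi>\<^sub>E i\<in>UNIV. {0..<int (p $ i)})"
  proof
    fix y
    assume "y \<in> range V"
    then obtain n where "y = V (w n)"
      using Vw by blast
    then have "y = V (vec_lambda (vec_nth (w n)))"
      by simp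
    moreover have "vec_nth (w n) \<in> (\<Pi>\<^sub>E i\<in>UNIV. {0..<int (p $ i)})"
      using w[of n] by (auto simp: fundamental_cell_def)
    ultimately show "y \<in> (\<lambda>f. V (vec_lambda f)) ` (\<Pi>\<^sub>E i\<in>UNIV. {0..<int (p $ i)})"
      by (rule image_eqI)
  qed
  moreover have "finite ((\<lambda>f. V (vec_lambda f)) ` (\<Pi>\<^sub>E i\<in>(UNIV :: 'd set). {0..<int (p $ i)}))"
    by (intro finite_imageI finite_PiE) auto
  ultimately show "finite (range V)"
    by (rule finite_subset)
qed

lemma asymptotics_from_bound:
  fixes F :: "real \<Rightarrow> ereal"
  assumes "1 \<le> n" "0 < \<epsilon>0"
    and F: "\<And>\<epsilon>. 0 < \<epsilon> \<Longrightarrow> \<epsilon> \<le> \<epsilon>0 \<Longrightarrow> \<exists>v. F (1 / \<epsilon>) = ereal v \<and> \<bar>v - \<epsilon> ^ (n - 1) * C\<bar> \<le> K * \<epsilon> ^ n"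
  shows "\<exists>r :: real \<Rightarrow> real. r \<in> O[at_top](\<lambda>\<mu>. \<mu> powi (- int n)) \<and>
    (\<forall>\<^sub>F \<mu> in at_top. F \<mu> = ereal (C * \<mu> powi (- int n + 1) + r \<mu>))"
proof -
  \<comment> \<open>For large \<open>\<mu>\<close> the value of \<open>F\<close> is finite, so
    \<open>real_of_ereal\<close> loses nothing there.\<close>
  define r where "r = (\<lambda>\<mu>. real_of_ereal (F \<mu>) - C * \<mu> powi (- int n + 1))"
  have *: "F \<mu> = ereal (C * \<mu> powi (- int n + 1) + r \<mu>) \<and> norm (r \<mu>) \<le> K * norm (\<mu> powi (- int n))"
    if "\<mu> \<ge> max 1 (1 / \<epsilon>0)" for \<mu>
  proof -
    have \<mu>: "0 < \<mu>" "1 / \<mu> \<le> \<epsilon>0"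
      using that assms(2) by (auto simp: field_simps)
    have e1: "\<mu> powi (- int n + 1) = (1 / \<mu>) ^ (n - 1)"
    proof -
      have "- int n + 1 = - int (n - 1)"
        using assms(1) by simp
      then show ?thesis
        by (simp only: power_int_minus power_int_of_nat) (simp add: power_divide divide_inverse power_inverse)
    qed
    have e2: "\<mu> powi (- int n) = (1 / \<mu>) ^ n"
      by (simp add: power_int_minus power_divide divide_inverse power_inverse)
    obtain v where "F \<mu> = ereal v" "\<bar>v - (1 / \<mu>) ^ (n - 1) * C\<bar> \<le> K * (1 / \<mu>) ^ n"
      using F[of "1 / \<mu>"] \<mu> by auto
    then show ?thesis
      using \<mu> unfolding r_def e1 e2 by (simp add: mult.commute)
  qed
  have "r \<in> O[at_top](\<lambda>\<mu>. \<mu> powi (- int n))"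
    using eventually_ge_at_top by (rule bigoI[of _ K, OF eventually_mono]) (use * in blast)
  moreover have "\<forall>\<^sub>F \<mu> in at_top. F \<mu> = ereal (C * \<mu> powi (- int n + 1) + r \<mu>)"
    using eventually_ge_at_top by (rule eventually_mono) (use * in blast)
  ultimately show ?thesis by blast
qed

theorem theorem2p1:
  fixes p :: "nat ^ 'd::finite" and V :: "int ^ 'd \<Rightarrow> real" and p0 :: nat
  assumes "\<And>i. 1 \<le> p $ i"
    and "periodic p V"
    and "non_degenerate p V"
    and "p0 = Min (range (\<lambda>i. p $ i))"
  shows "(\<exists>C>0. \<exists>r :: real \<Rightarrow> real. r \<in> O[at_top](\<lambda>\<mu>. \<mu> powi (- int p0)) \<and>
            (\<forall>\<^sub>F \<mu> in at_top. v_asy (schroedinger \<mu> V) = ereal (C * \<mu> powi (- int p0 + 1) + r \<mu>)))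
       \<and> (\<exists>c>0. \<exists>r :: real \<Rightarrow> real. r \<in> O[at_top](\<lambda>\<mu>. \<mu> powi (- int p0)) \<and>
            (\<forall>\<^sub>F \<mu> in at_top. v_asy_state (schroedinger \<mu> V) (ket 0)
                = ereal (c * \<mu> powi (- int p0 + 1) + r \<mu>)))"
proof -
  interpret periodic_potential p V
    using assms(1-3) by (rule periodic_potentialI)
  have p0_le: "p0 \<le> p $ i" for i
    using assms(4) by simp
  have "p0 \<in> range (\<lambda>i. p $ i)"
    unfolding assms(4) by (rule Min_in) auto
  then obtain j where j: "p0 = p $ j"
    by blast
  have p0: "1 \<le> p0"
    using j assms(1) by simp
  have "\<exists>L. posc i (B (p0 - 1)) L" for i
    using bnd_S_B unfolding bnd_def by blast
  then obtain T where T: "\<And>i. posc i (B (p0 - 1)) (T i)"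
    by metis
  define D where "D = {\<psi> :: (int ^ 'd) ell2. \<psi> \<in> position_domain \<and> norm \<psi> = 1}"
  define c where "c = vnorm T (ket 0)"
  define C where "C = (SUP \<psi>\<in>D. vnorm T \<psi>)"
  have ket: "ket 0 \<in> D"
    by (simp add: D_def ket_in_position_domain norm_ket)
  have bdd: "bdd_above (vnorm T ` D)"
  proof (rule bdd_aboveI2)
    show "vnorm T \<psi> \<le> (\<Sum>i\<in>UNIV. norm (T i))" if "\<psi> \<in> D" for \<psi>
      using that vnorm_le[of T \<psi>] by (simp add: D_def)
  qed
  have "0 < c"
  proof -
    let ?a = "axis j (int p0) :: int ^ 'd"
    \<comment> \<open>Translation by the period \<open>- ?a\<close> moves the nonzero entry into the
      column of \<open>ket 0\<close>; the commutator then multiplies it by \<open>- p0\<close>,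
      which is not 0.\<close>
    have "mel (B (p0 - 1)) (0 + - ?a) (?a + - ?a) = mel (B (p0 - 1)) 0 ?a"
      by (intro periD peri_B) (auto simp: axis_def j)
    then have "mel (B (p0 - 1)) (- ?a) 0 \<noteq> 0"
      using mel_B_axis_nonzero[of j] p0_le p0 j by simp
    then have "mel (T j) (- ?a) 0 \<noteq> 0"
      using p0 by (simp add: mel_posc[OF T] axis_def)
    then have "app (T j) (ket 0) \<noteq> 0"
      by (auto simp: mel_def zero_ell2.rep_eq)
    then have "(\<chi> i. app (T i) (ket 0)) \<noteq> 0"
      by (auto simp: vec_eq_iff)
    then show ?thesis
      by (simp add: c_def vnorm_def)
  qed
  moreover have "c \<le> C"
    unfolding c_def C_def by (rule cSUP_upper[OF ket bdd])
  ultimately have "0 < C"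
    by simp
  obtain \<epsilon>0 K where \<epsilon>0: "0 < \<epsilon>0" and est: "\<And>\<epsilon>. 0 < \<epsilon> \<Longrightarrow> \<epsilon> \<le> \<epsilon>0 \<Longrightarrow> \<exists>Y.
      (\<forall>\<psi>\<in>position_domain. v_asy_state (schroedinger (1 / \<epsilon>) V) \<psi> = ereal (vnorm Y \<psi>)) \<and>
      (\<Sum>i\<in>UNIV. norm (Y i - \<epsilon> ^ (p0 - 1) *\<^sub>R T i)) \<le> K * \<epsilon> ^ p0"
    using velocity_estimate[OF p0 p0_le T] by blast
  \<comment> \<open>A single \<open>f\<close> for each \<open>\<epsilon>\<close> serves both the
    supremum and the state \<open>ket 0\<close>.\<close>
  have bound: "\<exists>f. (\<forall>\<psi>\<in>D. v_asy_state (schroedinger (1 / \<epsilon>) V) \<psi> = ereal (f \<psi>)) \<and>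
      (\<forall>\<psi>\<in>D. \<bar>f \<psi> - \<epsilon> ^ (p0 - 1) * vnorm T \<psi>\<bar> \<le> K * \<epsilon> ^ p0)"
    if \<epsilon>: "0 < \<epsilon>" "\<epsilon> \<le> \<epsilon>0" for \<epsilon>
  proof -
    obtain Y where Y: "\<And>\<psi>. \<psi> \<in> position_domain \<Longrightarrow> v_asy_state (schroedinger (1 / \<epsilon>) V) \<psi> = ereal (vnorm Y \<psi>)"
      "(\<Sum>i\<in>UNIV. norm (Y i - \<epsilon> ^ (p0 - 1) *\<^sub>R T i)) \<le> K * \<epsilon> ^ p0"
      using est[OF \<epsilon>] by blast
    have "\<bar>vnorm Y \<psi> - \<epsilon> ^ (p0 - 1) * vnorm T \<psi>\<bar> \<le> K * \<epsilon> ^ p0" if "\<psi> \<in> D" for \<psi>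
      using vnorm_diff_le[of Y \<psi> "\<lambda>i. \<epsilon> ^ (p0 - 1) *\<^sub>R T i"] Y(2) that \<epsilon>
      by (simp add: vnorm_scaleR D_def)
    then show ?thesis
      using Y(1) by (intro exI[of _ "vnorm Y"]) (auto simp: D_def)
  qed
  have "\<exists>v. v_asy (schroedinger (1 / \<epsilon>) V) = ereal v \<and> \<bar>v - \<epsilon> ^ (p0 - 1) * C\<bar> \<le> K * \<epsilon> ^ p0"
    if \<epsilon>: "0 < \<epsilon>" "\<epsilon> \<le> \<epsilon>0" for \<epsilon>
  proof -
    obtain f where f: "\<And>\<psi>. \<psi> \<in> D \<Longrightarrow> v_asy_state (schroedinger (1 / \<epsilon>) V) \<psi> = ereal (f \<psi>)"
      "\<And>\<psi>. \<psi> \<in> D \<Longrightarrow> \<bar>f \<psi> - \<epsilon> ^ (p0 - 1) * vnorm T \<psi>\<bar> \<le> K * \<epsilon> ^ p0"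
      using bound[OF \<epsilon>] by blast
    have D: "D \<noteq> {}" and pos: "0 < \<epsilon> ^ (p0 - 1)"
      using ket \<epsilon> by auto
    note SUP = abs_SUP_diff_le[OF D bdd pos f(2)]
    have "v_asy (schroedinger (1 / \<epsilon>) V) = (SUP \<psi>\<in>D. ereal (f \<psi>))"
      unfolding v_asy_def D_def[symmetric] by (rule SUP_cong) (auto simp: f)
    also have "\<dots> = ereal (SUP \<psi>\<in>D. f \<psi>)"
    proof (rule ereal_SUP[symmetric])
      \<comment> \<open>The extended supremum is finite: it lies between its value at
        \<open>ket 0\<close> and the real supremum.\<close>
      have "(SUP \<psi>\<in>D. ereal (f \<psi>)) \<le> ereal (SUP \<psi>\<in>D. f \<psi>)"
        by (rule SUP_least) (simp add: cSUP_upper SUP(1))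
      moreover have "ereal (f (ket 0)) \<le> (SUP \<psi>\<in>D. ereal (f \<psi>))"
        by (rule SUP_upper[OF ket])
      ultimately show "\<bar>SUP \<psi>\<in>D. ereal (f \<psi>)\<bar> \<noteq> \<infinity>"
        by auto
    qed
    finally show ?thesis
      using SUP(2) by (auto simp: C_def)
  qed
  note v_asy = asymptotics_from_bound[OF p0 \<epsilon>0 this]
  have "\<exists>v. v_asy_state (schroedinger (1 / \<epsilon>) V) (ket 0) = ereal v \<and> \<bar>v - \<epsilon> ^ (p0 - 1) * c\<bar> \<le> K * \<epsilon> ^ p0"
    if \<epsilon>: "0 < \<epsilon>" "\<epsilon> \<le> \<epsilon>0" for \<epsilon>
    using bound[OF \<epsilon>] ket unfolding c_def by blast
  note v_asy_state = asymptotics_from_bound[OF p0 \<epsilon>0 this]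
  show ?thesis
    using v_asy v_asy_state \<open>0 < c\<close> \<open>0 < C\<close> by blast
qed

end
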